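(* For some constant $\epsilon\in(0,1)$, with $\mathscr{C}_1$ the class (depending on $\epsilon$) defined in the context, there is a static network-oblivious algorithm for the $(n,1)$-stencil problem ($n$ a power of two), specified on $M(n)$ and belonging to $\mathscr{C}_1$, such that: (a) when executed on $M(p,\sigma)$ its communication complexity is $$H_{\text{1-stencil}}(n,p,\sigma)=O\!\left(n\,4^{\sqrt{\log n}}\right)$$ for every power of two $p$ with $1<p\le n$ and $0\le\sigma=O(n/p)$ (i.e. for every constant $c>0$ the bound holds, with a constant depending on $c$, whenever $0\le\sigma\le c\,n/p$); (b) it is $(\Theta(1),n)$-wise, i.e. $(\alpha,n)$-wise for a constant $\alpha>0$; (c) it is $\Omega\!\left(1/4^{\sqrt{\log n}}\right)$-optimal with respect to $\mathscr{C}_1$ on any $M(p,\sigma)$ with $1<p\le n$ and $\sigma=O(n/p)$; that is, for every constant $c>0$ there is a constant $b>0$ such that it is $b/4^{\sqrt{\log n}}$-optimal whenever $1<p\le n$ and $0\le\sigma\le c\,n/p$.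
   Context: Problem: the $(n,1)$-stencil problem consists in evaluating all nodes of a DAG with $n^2$ nodes $\langle i_0,i_1\rangle$, $0\le i_0,i_1<n$, where each node $\langle i_0,i_1\rangle$ has an outgoing arc to each of $\langle i_0+\delta_0,i_1+1\rangle$, $\delta_0\in\{0,\pm1\}$, whenever such nodes exist. A node can be evaluated (in unit time) by a processing element holding the values of its predecessors. Class $\mathscr{C}_1$: static algorithms for the $(n,1)$-stencil problem such that any $\mathcal A\in\mathscr C_1$ for $q$ processing elements satisfies: (i) each DAG node is evaluated once (no recomputation); (ii) no processing element computes more than $\epsilon n^2$ DAG nodes, for some constant $0<\epsilon<1$; (iii) all foldings of $\mathcal A$ on $q'$ processing elements, $2\le q'<q$, also belong to $\mathscr C_1$. No assumption is made on input and output distributions. Conventions: $\log x$ means $\max\{1,\log_2 x\}$; numbers of processing elements are powers of two. Machine $M(v)$: $v$ processing elements (PEs) $P_0,\dots,P_{v-1}$, each a random access machine with unbounded local memory. An $M(v)$-algorithm runs as a sequence of supersteps, each with a label $i\in\{0,\dots,\log v-1\}$ (the label sequence is the same for all PEs). In an $i$-superstep each PE performs local computation and sends constant-size messages, only to PEs whose index agrees with its own in the $i$ most significant bits; the superstep ends with a barrier among such PEs, after which messages are available at their destinations. The algorithm is static if, for all inputs of the same size $n$, the number of supersteps, the sequence of labels, and the source-destination pairs of the messages of each superstep are the same. (Here the size parameter is the side $n$.) Folding: an $M(v)$-algorithm is executed on $M(p)$, $p<v$, by letting $P_j$ carry out the operations of the $v/p$ consecutively numbered PEs of $M(v)$ starting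 from the one with index $j(v/p)$. Supersteps with label $i<\log p$ keep their label; supersteps with label $i\ge\log p$ become local computation. For a static algorithm $\mathcal{A}$: $L^i_{\mathcal{A}}(n)$ is the set of $i$-supersteps, $S^i_{\mathcal{A}}(n)=|L^i_{\mathcal{A}}(n)|$; for $s\in L^i_{\mathcal{A}}(n)$, $i<\log p$, $h^s_{\mathcal{A}}(n,p)$ is the maximum number of messages sent by, or destined to, any processor in superstep $s$ when $\mathcal{A}$ is executed (folded) on $p$ processors (messages between PEs simulated by the same processor are not counted); $F^i_{\mathcal{A}}(n,p)=\sum_{s\in L^i_{\mathcal{A}}(n)}h^s_{\mathcal{A}}(n,p)$. Evaluation model $M(p,\sigma)$, $\sigma\ge0$: an $M(p)$ with communication complexity $H_{\mathcal{A}}(n,p,\sigma)=\sum_{i=0}^{\log p-1}\left(F^i_{\mathcal{A}}(n,p)+S^i_{\mathcal{A}}(n)\,\sigma\right)$. $M(p,\sigma)$-algorithms are $M(p)$-algorithms that may depend on $p$ and $\sigma$. A network-oblivious algorithm is specified on $M(v(n))$, where $v(n)$ depends only on the input size; it is executed on $M(p,\sigma)$, $p\le v(n)$, by folding, and $H$ refers to the folded algorithm. Optimality: for $0<\beta\le1$ ($\beta$ may depend on $n$), an $M(p,\sigma)$-algorithm $\mathcal{B}\in\mathscr{C}_1$ is $\beta$-optimal on $M(p,\sigma)$ with respect to $\mathscr{C}_1$ if $H_{\mathcal{B}}(n,p,\sigma)\le\frac1\beta H_{\mathcal{B}'}(n,p,\sigma)$ for each $M(p,\sigma)$-algorithm $\mathcal{B}'\in\mathscr{C}_1$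 (for each $n$ considered). Wiseness: a static network-oblivious algorithm $\mathcal{A}$ specified on $M(v(n))$ is $(\alpha,p)$-wise, $0<\alpha\le1$, $1<p\le v(n)$, if $\sum_{i=0}^{j-1}F^i_{\mathcal{A}}(n,2^j)\ge\alpha\frac{p}{2^j}\sum_{i=0}^{j-1}F^i_{\mathcal{A}}(n,p)$ for every $1\le j\le\log p$ and every $n$. *)

theory Defs
  imports Complex_Main "HOL-Library.Multiset" "HOL-Library.Discrete_Functions"
begin

definition is_pow2 :: "nat \<Rightarrow> bool" where
  "is_pow2 m \<longleftrightarrow> (\<exists>k. m = 2 ^ k)"

definition lg :: "real \<Rightarrow> real" where
  "lg x = max 1 (log 2 x)"


section \<open>The $(n,1)$-stencil DAG\<close>

type_synonym node = "nat \<times> nat"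

definition stencil_nodes :: "nat \<Rightarrow> node set" where
  "stencil_nodes n = {..<n} \<times> {..<n}"

text \<open>The disjunction says that the first coordinate changes by $0$, $+1$ or $-1$; it is written
  without subtraction because subtraction on naturals truncates.\<close>

definition stencil_arc :: "nat \<Rightarrow> node \<Rightarrow> node \<Rightarrow> bool" where
  "stencil_arc n u w \<longleftrightarrow> u \<in> stencil_nodes n \<and> w \<in> stencil_nodes n \<and> snd w = snd u + 1 \<and>
     (fst w = fst u \<or> fst w = fst u + 1 \<or> fst u = fst w + 1)"


section \<open>Executions and algorithms\<close>

text \<open>A message carries the value of one DAG node, or is a dummy message (payload \<open>None\<close>).
  In a superstep every processing element first evaluates the nodes listed for it in \<open>evals\<close>,
  in the order of the list, and then sends its messages, which are available at their
  destinations from the next superstep on.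

  On \<open>p\<close> processing elements, entries with label less than \<open>floor_log p\<close> are the supersteps of
  the machine. The other entries are pieces of local computation (see
  \<open>well_formed\<close>, where the cluster of such an entry is a single processing element);
  they arise by folding and are never charged.\<close>

record message =
  src :: nat
  dst :: nat
  payload :: "node option"

record superstep =
  label :: nat
  evals :: "(nat \<times> node) list"
  msgs :: "message list"

type_synonym execution = "superstep list"

text \<open>An algorithm for inputs of one fixed size maps each input to its execution. An input of
  size \<open>n\<close> consists of the \<open>n\<close> values of the first row of the DAG; nothing is said about which
  processing elements hold it.\<close>

type_synonym 'v algorithm = "'v list \<Rightarrow> execution"

definition inputs :: "nat \<Rightarrow> 'v list set" where
  "inputs n = {xs. length xs = n}"

text \<open>Processing elements of $M(p)$ have indices of $\log p$ bits; two indices agree in their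
  $i$ most significant bits iff they agree after dropping the $\log p - i$ least significant
  ones. For $i \ge \log p$ the truncated difference is $0$ and the indices must be equal.\<close>

definition same_cluster :: "nat \<Rightarrow> nat \<Rightarrow> nat \<Rightarrow> nat \<Rightarrow> bool" where
  "same_cluster p i j k \<longleftrightarrow> j div 2 ^ (floor_log p - i) = k div 2 ^ (floor_log p - i)"

definition well_formed :: "nat \<Rightarrow> execution \<Rightarrow> bool" where
  "well_formed p ex \<longleftrightarrow> (\<forall>s\<in>set ex.
     (\<forall>e\<in>set (evals s). fst e < p) \<and>
     (\<forall>m\<in>set (msgs s). src m < p \<and> dst m < p \<and> same_cluster p (label s) (src m) (dst m)))"

text \<open>In the following, \<open>K\<close> is the set of pairs \<open>(j, u)\<close> such that processing element \<open>j\<close>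
  holds the value of node \<open>u\<close>.\<close>

fun evals_ok :: "nat \<Rightarrow> (nat \<times> node) set \<Rightarrow> (nat \<times> node) list \<Rightarrow> bool" where
  "evals_ok n K [] \<longleftrightarrow> True"
| "evals_ok n K ((j, w) # es) \<longleftrightarrow>
     w \<in> stencil_nodes n \<and> (\<forall>u. stencil_arc n u w \<longrightarrow> (j, u) \<in> K) \<and>
     evals_ok n (insert (j, w) K) es"

definition msgs_ok :: "(nat \<times> node) set \<Rightarrow> message list \<Rightarrow> bool" where
  "msgs_ok K ms \<longleftrightarrow> (\<forall>m\<in>set ms. \<forall>u. payload m = Some u \<longrightarrow> (src m, u) \<in> K)"

definition delivered :: "message list \<Rightarrow> (nat \<times> node) set" where
  "delivered ms = {(dst m, u) | m u. m \<in> set ms \<and> payload m = Some u}"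

fun execution_ok :: "nat \<Rightarrow> (nat \<times> node) set \<Rightarrow> execution \<Rightarrow> bool" where
  "execution_ok n K [] \<longleftrightarrow> True"
| "execution_ok n K (s # ss) \<longleftrightarrow>
     evals_ok n K (evals s) \<and>
     msgs_ok (K \<union> set (evals s)) (msgs s) \<and>
     execution_ok n (K \<union> set (evals s) \<union> delivered (msgs s)) ss"

definition all_evals :: "execution \<Rightarrow> (nat \<times> node) list" where
  "all_evals ex = concat (map evals ex)"

definition solves_stencil :: "nat \<Rightarrow> nat \<Rightarrow> execution \<Rightarrow> bool" where
  "solves_stencil n p ex \<longleftrightarrow>
     well_formed p ex \<and> execution_ok n {} ex \<and> stencil_nodes n \<subseteq> snd ` set (all_evals ex)"

definition no_recomputation :: "execution \<Rightarrow> bool" where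
  "no_recomputation ex \<longleftrightarrow> distinct (map snd (all_evals ex))"

definition work :: "nat \<Rightarrow> execution \<Rightarrow> nat" where
  "work j ex = length (filter (\<lambda>e. fst e = j) (all_evals ex))"

definition comm_pattern :: "execution \<Rightarrow> (nat \<times> (nat \<times> nat) multiset) list" where
  "comm_pattern ex = map (\<lambda>s. (label s, mset (map (\<lambda>m. (src m, dst m)) (msgs s)))) ex"

definition static_on :: "nat \<Rightarrow> 'v algorithm \<Rightarrow> bool" where
  "static_on n A \<longleftrightarrow> (\<forall>x\<in>inputs n. \<forall>y\<in>inputs n. comm_pattern (A x) = comm_pattern (A y))"

text \<open>The algorithm as written for $M(v)$, before any folding, has only supersteps.\<close>

definition static_algorithm_specified_on :: "nat \<Rightarrow> nat \<Rightarrow> 'v algorithm \<Rightarrow> bool" where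
  "static_algorithm_specified_on n v A \<longleftrightarrow>
     static_on n A \<and>
     (\<forall>x\<in>inputs n. solves_stencil n v (A x) \<and> (\<forall>s\<in>set (A x). label s < floor_log v))"


section \<open>Folding\<close>

text \<open>Labels are kept: an entry whose label is at least \<open>floor_log p\<close> is local
  computation on \<open>p\<close> processing elements.\<close>

definition fold_superstep :: "nat \<Rightarrow> nat \<Rightarrow> superstep \<Rightarrow> superstep" where
  "fold_superstep v p s =
     s\<lparr>evals := map (\<lambda>(j, w). (j div (v div p), w)) (evals s),
       msgs := map (\<lambda>m. m\<lparr>src := src m div (v div p), dst := dst m div (v div p)\<rparr>) (msgs s)\<rparr>"

definition fold_algorithm :: "nat \<Rightarrow> nat \<Rightarrow> 'v algorithm \<Rightarrow> 'v algorithm" where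
  "fold_algorithm v p A = (\<lambda>x. map (fold_superstep v p) (A x))"


section \<open>Communication complexity\<close>

definition sent :: "nat \<Rightarrow> superstep \<Rightarrow> nat" where
  "sent j s = length (filter (\<lambda>m. src m = j \<and> dst m \<noteq> j) (msgs s))"

definition received :: "nat \<Rightarrow> superstep \<Rightarrow> nat" where
  "received j s = length (filter (\<lambda>m. dst m = j \<and> src m \<noteq> j) (msgs s))"

definition superstep_degree :: "nat \<Rightarrow> superstep \<Rightarrow> nat" where
  "superstep_degree p s = Max ((\<lambda>j. max (sent j s) (received j s)) ` {..<p})"

definition num_supersteps :: "nat \<Rightarrow> execution \<Rightarrow> nat" where
  "num_supersteps i ex = length (filter (\<lambda>s. label s = i) ex)"

definition total_degree :: "nat \<Rightarrow> nat \<Rightarrow> execution \<Rightarrow> nat" where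
  "total_degree i p ex = (\<Sum>s\<leftarrow>filter (\<lambda>s. label s = i) ex. superstep_degree p s)"

text \<open>\<open>ex\<close> is the execution on $M(p)$, that is, after folding.\<close>

definition comm_complexity :: "nat \<Rightarrow> real \<Rightarrow> execution \<Rightarrow> real" where
  "comm_complexity p \<sigma> ex =
     (\<Sum>i<floor_log p. real (total_degree i p ex) + real (num_supersteps i ex) * \<sigma>)"


section \<open>The class of algorithms, optimality, wiseness\<close>

inductive stencil_class :: "real \<Rightarrow> nat \<Rightarrow> nat \<Rightarrow> 'v algorithm \<Rightarrow> bool" for \<epsilon> :: real and n :: nat where
  "\<lbrakk> is_pow2 q; static_on n A;
     \<forall>x\<in>inputs n. solves_stencil n q (A x);
     \<forall>x\<in>inputs n. no_recomputation (A x);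
     \<forall>x\<in>inputs n. \<forall>j<q. real (work j (A x)) \<le> \<epsilon> * real n ^ 2;
     \<forall>q'. is_pow2 q' \<and> 2 \<le> q' \<and> q' < q \<longrightarrow> stencil_class \<epsilon> n q' (fold_algorithm q q' A) \<rbrakk>
   \<Longrightarrow> stencil_class \<epsilon> n q A"

text \<open>For a static algorithm the communication complexity is the same for all inputs of size
  \<open>n\<close>, so the quantification over inputs only fixes a common value.\<close>

definition optimal_on :: "real \<Rightarrow> real \<Rightarrow> nat \<Rightarrow> nat \<Rightarrow> real \<Rightarrow> 'v algorithm \<Rightarrow> bool" where
  "optimal_on \<beta> \<epsilon> n p \<sigma> B \<longleftrightarrow>
     0 < \<beta> \<and> \<beta> \<le> 1 \<and> stencil_class \<epsilon> n p B \<and>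
     (\<forall>B' :: 'v algorithm. stencil_class \<epsilon> n p B' \<longrightarrow>
        (\<forall>x\<in>inputs n. comm_complexity p \<sigma> (B x) \<le> 1 / \<beta> * comm_complexity p \<sigma> (B' x)))"

definition wise_on :: "nat \<Rightarrow> nat \<Rightarrow> real \<Rightarrow> nat \<Rightarrow> 'v algorithm \<Rightarrow> bool" where
  "wise_on n v \<alpha> p A \<longleftrightarrow>
     0 < \<alpha> \<and> \<alpha> \<le> 1 \<and> 1 < p \<and> p \<le> v \<and>
     (\<forall>x\<in>inputs n. \<forall>j. 1 \<le> j \<and> j \<le> floor_log p \<longrightarrow>
        (\<Sum>i<j. real (total_degree i (2 ^ j) (fold_algorithm v (2 ^ j) A x)))
          \<ge> \<alpha> * (real p / 2 ^ j) * (\<Sum>i<j. real (total_degree i p (fold_algorithm v p A x))))"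

end

theory Submission
  imports Defs
begin

text \<open>
  The algorithm gives the diagonals \<open>i + t \<in> {2 * j, 2 * j + 1}\<close> of the nodes \<open>(i, t)\<close> to
  processing element \<open>j\<close>, so that values only move from \<open>j\<close> to \<open>j + 1\<close>. Processing element
  \<open>j + 1\<close> runs behind \<open>j\<close> by the size \<open>2 ^ (v + 1)\<close> of the smallest cluster that contains both, and
  the boundary between them is crossed in batches of that many rows, once every \<open>2 ^ (v + 1)\<close> time
  steps. A batch is spread over the lower half of the cluster by \<open>v\<close> doublings on the way out, is
  shifted to the upper half, and is gathered by \<open>v\<close> halvings. Hence every superstep moves a bounded
  number of messages per processing element, and since the total delay is only \<open>O(n log n)\<close>, there
  are \<open>O(2 ^ l * log n)\<close> supersteps with label less than \<open>l\<close>. The cost is therefore \<open>O(n log n)\<close>,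
  which is below the required bound as \<open>x \<le> 2 * 4 powr sqrt x\<close>.

  For the lower bound, consider the part of a square grid of side \<open>m\<close> inside the DAG that one
  processing element evaluates. If it is between \<open>1 / 8\<close> and \<open>3 / 4\<close> of the grid, then a third of
  the rows or a third of the columns are shared with other processing elements, and each of
  them costs a message. If all parts are smaller, pass to the first and the last quadrant of a
  grid of diagonals: the shares at most quadruple, the side is halved, and the two quadrants are
  evaluated one after the other, so that their costs add up.\<close>

section \<open>Executions by superstep index\<close>

definition learned :: "superstep \<Rightarrow> (nat \<times> node) set" where
  "learned s = set (evals s) \<union> delivered (msgs s)"

definition known :: "execution \<Rightarrow> nat \<Rightarrow> (nat \<times> node) set" where
  "known ex s = (\<Union>r<s. learned (ex ! r))"

lemma known_Cons_Suc: "known (a # ex) (Suc s) = learned a \<union> known ex s"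
  unfolding known_def by (simp add: lessThan_Suc_eq_insert_0 image_image)

lemma known_Suc: "known ex (Suc s) = known ex s \<union> learned (ex ! s)"
  by (auto simp: known_def less_Suc_eq)

text \<open>The recursion becomes a condition at every index \<open>s\<close>, so that superstep
  indices can serve as a clock in the lower bound.\<close>

lemma execution_ok_iff:
  "execution_ok n K ex \<longleftrightarrow>
    (\<forall>s<length ex. evals_ok n (K \<union> known ex s) (evals (ex ! s)) \<and>
       msgs_ok (K \<union> known ex s \<union> set (evals (ex ! s))) (msgs (ex ! s)))"
proof (induction ex arbitrary: K)
  case (Cons a ex)
  have 0: "known (a # ex) 0 = {}"
    by (simp add: known_def)
  have K: "K \<union> set (evals a) \<union> delivered (msgs a) = K \<union> learned a"
    by (auto simp: learned_def)
  have ok: "execution_ok n K (a # ex) \<longleftrightarrow> evals_ok n K (evals a) \<and>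
      msgs_ok (K \<union> set (evals a)) (msgs a) \<and> execution_ok n (K \<union> learned a) ex"
    unfolding K[symmetric] by (rule execution_ok.simps)
  show ?case
    unfolding ok Cons.IH length_Cons All_less_Suc2 nth_Cons_0 nth_Cons_Suc
      known_Cons_Suc 0 Un_empty_left Un_empty_right Un_assoc conj_assoc ..
qed simp

text \<open>The order inside the list is given up: a predecessor may come from anywhere in
  \<open>es\<close>. This is enough where time is measured in whole supersteps.\<close>

lemma evals_okD:
  assumes "evals_ok n K es" "(j, w) \<in> set es"
  shows "w \<in> stencil_nodes n" "stencil_arc n u w \<Longrightarrow> (j, u) \<in> K \<union> set es"
  using assms
  by (induction n K es rule: evals_ok.induct) (auto simp del: split_paired_All split_paired_Ex)

lemma distinct_concat_index:
  assumes "distinct (concat xss)" "r < length xss" "s < length xss"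
    and "x \<in> set (xss ! r)" "x \<in> set (xss ! s)"
  shows "r = s"
  using assms
proof (induction xss arbitrary: r s)
  case (Cons xs xss)
  have *: "\<And>i. i < length xss \<Longrightarrow> x \<in> set (xss ! i) \<Longrightarrow> x \<notin> set xs"
    using Cons.prems(1) by (auto simp: disjoint_iff)
  show ?case
    using Cons.prems Cons.IH[of "r - 1" "s - 1"] * by (cases r; cases s) auto
qed simp

text \<open>Exchange of sums: each superstep contributes once, under its own label.\<close>

lemma comm_complexity_eq:
  "comm_complexity p \<sigma> ex =
    (\<Sum>s\<leftarrow>ex. if label s < floor_log p then real (superstep_degree p s) + \<sigma> else 0)"
proof (induction ex)
  case Nil
  then show ?case
    by (simp add: comm_complexity_def total_degree_def num_supersteps_def)
next
  case (Cons s ex)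
  have "comm_complexity p \<sigma> (s # ex) = comm_complexity p \<sigma> ex +
      (\<Sum>i<floor_log p. if i = label s then real (superstep_degree p s) + \<sigma> else 0)"
    unfolding comm_complexity_def sum.distrib[symmetric]
    by (intro sum.cong) (auto simp: total_degree_def num_supersteps_def algebra_simps)
  then show ?case
    using Cons.IH by simp
qed

lemma sum_total_degree_eq:
  "(\<Sum>i<j. real (total_degree i p ex)) =
    (\<Sum>s\<leftarrow>ex. if label s < j then real (superstep_degree p s) else 0)"
proof (induction ex)
  case (Cons s ex)
  have "(\<Sum>i<j. real (total_degree i p (s # ex))) = (\<Sum>i<j. real (total_degree i p ex)) +
      (\<Sum>i<j. if i = label s then real (superstep_degree p s) else 0)"
    unfolding sum.distrib[symmetric]
    by (intro sum.cong) (auto simp: total_degree_def)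
  then show ?case
    using Cons.IH by simp
qed (simp add: total_degree_def)

section \<open>A lower bound on the communication complexity\<close>

definition mixed_rows :: "nat \<Rightarrow> (nat \<times> nat) set \<Rightarrow> nat set" where
  "mixed_rows m S = {a. a < m \<and> (\<exists>b<m. \<exists>b'<m. (a, b) \<in> S \<and> (a, b') \<notin> S)}"

definition mixed_columns :: "nat \<Rightarrow> (nat \<times> nat) set \<Rightarrow> nat set" where
  "mixed_columns m S = {b. b < m \<and> (\<exists>a<m. \<exists>a'<m. (a, b) \<in> S \<and> (a', b) \<notin> S)}"

text \<open>Any unmixed row meets any unmixed column, so all unmixed lines have the same color; the
  other color then lives where mixed rows meet mixed columns.\<close>

lemma grid_isoperimetry:
  assumes S: "S \<subseteq> {..<m} \<times> {..<m}"
    and lower: "m\<^sup>2 \<le> 8 * card S" and upper: "4 * card S \<le> 3 * m\<^sup>2"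
  shows "m \<le> 3 * card (mixed_rows m S) \<or> m \<le> 3 * card (mixed_columns m S)"
proof (rule ccontr)
  let ?R = "mixed_rows m S" and ?C = "mixed_columns m S"
  assume "\<not> ?thesis"
  then have less: "3 * card ?R < m" "3 * card ?C < m" and m: "m > 0"
    by auto
  have fin: "finite ?R" "finite ?C"
    by (simp_all add: mixed_rows_def mixed_columns_def)
  have "card ?R < card {..<m}" "card ?C < card {..<m}"
    using less by auto
  then have "?R \<noteq> {..<m}" "?C \<noteq> {..<m}"
    by (metis less_irrefl)+
  moreover have "?R \<subseteq> {..<m}" "?C \<subseteq> {..<m}"
    by (auto simp: mixed_rows_def mixed_columns_def)
  ultimately obtain a0 b0 where ab0: "a0 < m" "a0 \<notin> ?R" "b0 < m" "b0 \<notin> ?C"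
    by blast
  have row: "((a, b) \<in> S) = ((a, b') \<in> S)" if "a < m" "a \<notin> ?R" "b < m" "b' < m" for a b b'
    using that by (auto simp: mixed_rows_def)
  have col: "((a, b) \<in> S) = ((a', b) \<in> S)" if "b < m" "b \<notin> ?C" "a < m" "a' < m" for a a' b
    using that by (auto simp: mixed_columns_def)
  have same: "((a, b) \<in> S) = ((a0, b0) \<in> S)" if "a < m" "b < m" "a \<notin> ?R \<or> b \<notin> ?C" for a b
    using that ab0 row[of a b b0] row[of a0 b b0] col[of b a a0] col[of b0 a a0] by blast
  \<comment> \<open>The color other than that of \<open>(a0, b0)\<close> fills less than a ninth of
    the grid, while \<open>S\<close> has at least an eighth and its complement at least a
    quarter.\<close>
  have "9 * (card ?R * card ?C) < m\<^sup>2"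
    using mult_strict_mono[OF less] m by (simp add: power2_eq_square)
  then have RC: "9 * card (?R \<times> ?C) < m\<^sup>2"
    by (simp add: card_cartesian_product)
  have finS: "finite S"
    using S finite_subset by blast
  show False
  proof (cases "(a0, b0) \<in> S")
    case True
    have "{..<m} \<times> {..<m} - S \<subseteq> ?R \<times> ?C"
      using same True by blast
    then have "card ({..<m} \<times> {..<m} - S) \<le> card (?R \<times> ?C)"
      using fin by (intro card_mono) auto
    then have "m\<^sup>2 - card S \<le> card (?R \<times> ?C)"
      using S finS by (simp add: card_Diff_subset card_cartesian_product power2_eq_square)
    then show False
      using RC upper by linarith
  next
    case False
    have "S \<subseteq> ?R \<times> ?C"
      using same False S by blast
    then have "card S \<le> card (?R \<times> ?C)"
      using fin by (intro card_mono) auto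
    then show False
      using RC lower by linarith
  qed
qed

section \<open>Paths of arcs and cuts\<close>

definition linked :: "nat \<Rightarrow> node set \<Rightarrow> bool" where
  "linked n A \<longleftrightarrow> (\<forall>B. A \<inter> B \<noteq> {} \<and> A - B \<noteq> {} \<longrightarrow>
     (\<exists>u\<in>A. \<exists>w\<in>A. stencil_arc n u w \<and> (u \<in> B) \<noteq> (w \<in> B)))"

text \<open>Membership in \<open>B\<close> is the same along the whole path unless it changes
  between two consecutive nodes, which are joined by an arc. Later \<open>B\<close> is the set of
  nodes evaluated by one processing element.\<close>

lemma linked_path:
  assumes "\<And>i. Suc i < m \<Longrightarrow> stencil_arc n (g i) (g (Suc i)) \<or> stencil_arc n (g (Suc i)) (g i)"
  shows "linked n (g ` {..<m})"
  unfolding linked_def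
proof (intro allI impI, rule ccontr)
  fix B assume B: "g ` {..<m} \<inter> B \<noteq> {} \<and> g ` {..<m} - B \<noteq> {}"
    and none: "\<not> (\<exists>u\<in>g ` {..<m}. \<exists>w\<in>g ` {..<m}. stencil_arc n u w \<and> (u \<in> B) \<noteq> (w \<in> B))"
  have step: "(g i \<in> B) = (g (Suc i) \<in> B)" if "Suc i < m" for i
  proof -
    have "g i \<in> g ` {..<m}" "g (Suc i) \<in> g ` {..<m}"
      using that by auto
    then show ?thesis
      using assms[OF that] none by blast
  qed
  have "(g i \<in> B) = (g 0 \<in> B)" if "i < m" for i
    using that
  proof (induction i)
    case (Suc i)
    then show ?case
      using step[of i] by simp
  qed simp
  moreover obtain i i' where "i < m" "g i \<in> B" "i' < m" "g i' \<notin> B"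
    using B by blast
  ultimately show False
    by metis
qed

section \<open>Place and time of evaluation in a run without recomputation\<close>

locale stencil_run =
  fixes n p :: nat and ex :: execution
  assumes solves: "solves_stencil n p ex" and once: "no_recomputation ex"
begin

text \<open>For nodes of the DAG the choices made here and in \<open>host\<close> are forced, by
  \<open>eval_unique\<close>.\<close>

definition stage :: "node \<Rightarrow> nat" where
  "stage u = (SOME s. s < length ex \<and> u \<in> snd ` set (evals (ex ! s)))"

definition host :: "node \<Rightarrow> nat" where
  "host u = (SOME j. (j, u) \<in> set (evals (ex ! stage u)))"

lemma evaluated:
  assumes "u \<in> stencil_nodes n"
  shows "stage u < length ex" "(host u, u) \<in> set (evals (ex ! stage u))"
proof -
  have "u \<in> snd ` set (all_evals ex)"
    using solves assms by (auto simp: solves_stencil_def)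
  then obtain x where "x \<in> set ex" "u \<in> snd ` set (evals x)"
    by (auto simp: all_evals_def)
  then obtain s where "s < length ex \<and> u \<in> snd ` set (evals (ex ! s))"
    by (metis in_set_conv_nth)
  then have *: "stage u < length ex \<and> u \<in> snd ` set (evals (ex ! stage u))"
    unfolding stage_def by (rule someI)
  then show "stage u < length ex"
    by simp
  from * obtain j where "(j, u) \<in> set (evals (ex ! stage u))"
    by auto
  then show "(host u, u) \<in> set (evals (ex ! stage u))"
    unfolding host_def by (rule someI)
qed

lemma run_ok:
  assumes "s < length ex"
  shows "evals_ok n (known ex s) (evals (ex ! s))"
    "msgs_ok (known ex s \<union> set (evals (ex ! s))) (msgs (ex ! s))"
  using solves assms unfolding solves_stencil_def execution_ok_iff by auto

text \<open>Each node occurs once among all evaluations: distinctness of the concatenation fixes the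
  superstep, distinctness inside the superstep fixes the processing element.\<close>

lemma eval_unique:
  assumes "s < length ex" "(j, u) \<in> set (evals (ex ! s))"
  shows "u \<in> stencil_nodes n" "s = stage u" "j = host u"
proof -
  show u: "u \<in> stencil_nodes n"
    using run_ok(1)[OF assms(1)] assms(2) evals_okD(1) by blast
  have dist: "distinct (concat (map (\<lambda>s. map snd (evals s)) ex))"
    using once by (simp add: no_recomputation_def all_evals_def map_concat comp_def)
  have "u \<in> snd ` set (evals (ex ! s))" "u \<in> snd ` set (evals (ex ! stage u))"
    using rev_image_eqI[OF assms(2), of u snd] rev_image_eqI[OF evaluated(2)[OF u], of u snd]
    by simp_all
  then show s: "s = stage u"
    using assms(1) evaluated(1)[OF u] by (intro distinct_concat_index[OF dist, where x = u]) simp_all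
  have "map snd (evals (ex ! s)) \<in> set (map (\<lambda>s. map snd (evals s)) ex)"
    using assms(1) by simp
  then have "distinct (map snd (evals (ex ! s)))"
    using dist unfolding distinct_concat_iff by blast
  then have "inj_on snd (set (evals (ex ! s)))"
    by (simp add: distinct_map)
  then show "j = host u"
    using inj_onD[of snd _ "(j, u)" "(host u, u)"] assms(2) evaluated(2)[OF u] s by simp
qed

text \<open>The range of supersteps is half-open, so that consecutive ranges share no superstep and
  their traffic adds up.\<close>

definition carried :: "nat \<Rightarrow> nat \<Rightarrow> nat \<Rightarrow> node \<Rightarrow> bool" where
  "carried a b j u \<longleftrightarrow> (\<exists>r. a \<le> r \<and> r < b \<and> (\<exists>m\<in>set (msgs (ex ! r)). payload m = Some u \<and>
     ((src m = j \<and> dst m \<noteq> j) \<or> (dst m = j \<and> src m \<noteq> j))))"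

lemma carried_mono: "carried a b j u \<Longrightarrow> a' \<le> a \<Longrightarrow> b \<le> b' \<Longrightarrow> carried a' b' j u"
  unfolding carried_def by (meson le_trans less_le_trans)

text \<open>Follow the value from its host. The message that brings it to \<open>j\<close> comes
  either from the host or from a processing element that obtained it earlier. Both \<open>j\<close>
  and the host are recorded, because a cut may be observed from either end of an arc.\<close>

lemma knownD:
  assumes "s \<le> length ex" "(j, u) \<in> known ex s"
  shows "u \<in> stencil_nodes n \<and> stage u < s \<and>
    (j \<noteq> host u \<longrightarrow> carried (stage u) s j u \<and> carried (stage u) s (host u) u)"
  using assms
proof (induction s arbitrary: j u)
  case 0
  then show ?case
    by (simp add: known_def)
next
  case (Suc s)
  note IH = Suc.IH[OF Suc_leD[OF Suc.prems(1)]]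
  have s: "s < length ex"
    using Suc.prems by simp
  have mono: "carried (stage u) (Suc s) k u" if "carried (stage u) s k u" for k
    using carried_mono[OF that] by simp
  from Suc.prems(2) consider "(j, u) \<in> known ex s" | "(j, u) \<in> set (evals (ex ! s))"
    | m where "m \<in> set (msgs (ex ! s))" "dst m = j" "payload m = Some u"
    by (auto simp: known_Suc learned_def delivered_def)
  then show ?case
  proof cases
    case 1
    show ?thesis
      using IH[OF 1] mono by auto
  next
    case 2
    show ?thesis
      using eval_unique[OF s 2] by auto
  next
    case 3
    then have "(src m, u) \<in> known ex s \<union> set (evals (ex ! s))"
      using run_ok(2)[OF s] unfolding msgs_ok_def by blast
    then have *: "u \<in> stencil_nodes n \<and> stage u \<le> s \<and>
        (src m \<noteq> host u \<longrightarrow> carried (stage u) s (src m) u \<and> carried (stage u) s (host u) u)"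
      using IH[of "src m" u] eval_unique[OF s, of "src m" u] by fastforce
    \<comment> \<open>A message between different processing elements counts for its source and its
      destination alike; a message to oneself conveys nothing new.\<close>
    have new: "carried (stage u) (Suc s) j u" "carried (stage u) (Suc s) (src m) u"
      if "src m \<noteq> j"
      unfolding carried_def
      by (intro exI[of _ s] conjI bexI[of _ m], use 3 that * in simp_all)+
    show ?thesis
    proof (cases "src m = j")
      case True
      then show ?thesis
        using * mono by auto
    next
      case False
      then show ?thesis
        using * new mono[of "host u"] by (cases "src m = host u") auto
    qed
  qed
qed

text \<open>The value can leave \<open>host u\<close> in superstep \<open>stage u\<close> itself,
  since evaluations precede messages, but must reach \<open>host w\<close> before
  \<open>stage w\<close>, since messages are available only in later supersteps.\<close>

lemma arc_stage:
  assumes "stencil_arc n u w"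
  shows "stage u \<le> stage w"
    and "host u \<noteq> host w \<Longrightarrow> j = host u \<or> j = host w \<Longrightarrow> carried (stage u) (stage w) j u"
proof -
  have w: "w \<in> stencil_nodes n"
    using assms by (simp add: stencil_arc_def)
  note ev = evaluated[OF w]
  have known: "(host w, u) \<in> known ex (stage w) \<union> set (evals (ex ! stage w))"
    using evals_okD(2)[OF run_ok(1)[OF ev(1)] ev(2) assms] .
  have same: "host w = host u \<and> stage w = stage u"
    if "(host w, u) \<in> set (evals (ex ! stage w))"
    using eval_unique[OF ev(1) that] by simp
  have "stage u \<le> stage w \<and> (host u \<noteq> host w \<longrightarrow>
      carried (stage u) (stage w) (host u) u \<and> carried (stage u) (stage w) (host w) u)"
  proof (cases "(host w, u) \<in> set (evals (ex ! stage w))")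
    case False
    then show ?thesis
      using known knownD[of "stage w" "host w" u] ev(1) by auto
  qed (use same in auto)
  then show "stage u \<le> stage w"
    and "host u \<noteq> host w \<Longrightarrow> j = host u \<or> j = host w \<Longrightarrow> carried (stage u) (stage w) j u"
    by auto
qed

section \<open>Traffic forced by a mixed grid\<close>

definition traffic :: "nat \<Rightarrow> nat \<Rightarrow> nat" where
  "traffic a b = (\<Sum>s\<in>{a..<b}. superstep_degree p (ex ! s))"

text \<open>Distinct values travel in distinct messages. The factor 2 is there because the degree of
  a superstep bounds sent and received messages separately.\<close>

lemma card_carried_le_traffic:
  assumes j: "j < p" and U: "\<And>u. u \<in> U \<Longrightarrow> carried a b j u"
  shows "card U \<le> 2 * traffic a b"
proof -
  let ?out = "\<lambda>r. filter (\<lambda>m. src m = j \<and> dst m \<noteq> j) (msgs (ex ! r))"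
  let ?in = "\<lambda>r. filter (\<lambda>m. dst m = j \<and> src m \<noteq> j) (msgs (ex ! r))"
  let ?pay = "\<lambda>r. (\<lambda>m. the (payload m)) ` set (?out r @ ?in r)"
  have "U \<subseteq> (\<Union>r\<in>{a..<b}. ?pay r)"
  proof
    fix u assume "u \<in> U"
    then obtain r m where "a \<le> r" "r < b" "m \<in> set (?out r @ ?in r)" "payload m = Some u"
      using U[of u] unfolding carried_def by auto
    then show "u \<in> (\<Union>r\<in>{a..<b}. ?pay r)"
      by (intro UN_I[of r] rev_image_eqI[of m]) simp_all
  qed
  then have "card U \<le> card (\<Union>r\<in>{a..<b}. ?pay r)"
    by (intro card_mono) auto
  also have "\<dots> \<le> (\<Sum>r\<in>{a..<b}. card (?pay r))"
    by (rule card_UN_le) simp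
  also have "\<dots> \<le> (\<Sum>r\<in>{a..<b}. 2 * superstep_degree p (ex ! r))"
  proof (rule sum_mono)
    fix r
    \<comment> \<open>A dummy message puts an arbitrary value into \<open>?pay\<close>, which is
      harmless in an upper bound.\<close>
    have "card (?pay r) \<le> length (?out r @ ?in r)"
      by (meson card_image_le card_length finite_set le_trans)
    also have "\<dots> = sent j (ex ! r) + received j (ex ! r)"
      by (simp add: sent_def received_def)
    also have "\<dots> \<le> 2 * max (sent j (ex ! r)) (received j (ex ! r))"
      by simp
    also have "max (sent j (ex ! r)) (received j (ex ! r)) \<le> superstep_degree p (ex ! r)"
      unfolding superstep_degree_def using j by (intro Max_ge) auto
    finally show "card (?pay r) \<le> 2 * superstep_degree p (ex ! r)"
      by simp
  qed
  finally show ?thesis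
    by (simp add: traffic_def sum_distrib_left)
qed

definition hosted :: "nat \<Rightarrow> node set" where
  "hosted j = {u \<in> stencil_nodes n. host u = j}"

text \<open>Here \<open>f\<close> embeds a grid whose lines are connected by arcs. Each mixed line
  yields a carried node on that line, and different rows, or different columns, yield different
  nodes. A third of \<open>m\<close> lines and the factor 2 of
  \<open>card_carried_le_traffic\<close> give the constant 6.\<close>

lemma grid_traffic:
  fixes f :: "nat \<times> nat \<Rightarrow> node"
  assumes j: "j < p" and inj: "inj_on f ({..<m} \<times> {..<m})"
    and nodes: "\<And>z. z \<in> {..<m} \<times> {..<m} \<Longrightarrow> f z \<in> stencil_nodes n"
    and row: "\<And>x. x < m \<Longrightarrow> linked n ((\<lambda>y. f (x, y)) ` {..<m})"
    and col: "\<And>y. y < m \<Longrightarrow> linked n ((\<lambda>x. f (x, y)) ` {..<m})"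
    and time: "\<And>z. z \<in> {..<m} \<times> {..<m} \<Longrightarrow> a \<le> stage (f z) \<and> stage (f z) \<le> b"
    and lower: "m\<^sup>2 \<le> 8 * card {z \<in> {..<m} \<times> {..<m}. host (f z) = j}"
    and upper: "4 * card {z \<in> {..<m} \<times> {..<m}. host (f z) = j} \<le> 3 * m\<^sup>2"
  shows "m \<le> 6 * traffic a b"
proof -
  define S where "S = {z \<in> {..<m} \<times> {..<m}. host (f z) = j}"
  have inS: "z \<in> S \<longleftrightarrow> f z \<in> hosted j" if "z \<in> {..<m} \<times> {..<m}" for z
    using that nodes[OF that] by (auto simp: S_def hosted_def)
  \<comment> \<open>The cut by \<open>hosted j\<close> is crossed by an arc inside the line. Exactly
    one of its ends is hosted by \<open>j\<close>, so the value of its tail passes the boundary of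
    \<open>j\<close>.\<close>
  have cross: "\<exists>z\<in>Z. carried a b j (f z)"
    if "linked n (f ` Z)" "Z \<subseteq> {..<m} \<times> {..<m}" "z \<in> Z" "z \<in> S" "z' \<in> Z" "z' \<notin> S" for Z z z'
  proof -
    have "f ` Z \<inter> hosted j \<noteq> {} \<and> f ` Z - hosted j \<noteq> {}"
      using that inS by blast
    then have "\<exists>u\<in>f ` Z. \<exists>w\<in>f ` Z. stencil_arc n u w \<and> (u \<in> hosted j) \<noteq> (w \<in> hosted j)"
      by (rule that(1)[unfolded linked_def, rule_format])
    then obtain z z' where z: "z \<in> Z" "z' \<in> Z" "stencil_arc n (f z) (f z')"
        "(f z \<in> hosted j) \<noteq> (f z' \<in> hosted j)"
      by (elim bexE imageE conjE) simp
    then have "carried (stage (f z)) (stage (f z')) j (f z)"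
      using arc_stage(2)[OF z(3), of j] z(4) z(1,2) nodes that(2) unfolding hosted_def by auto
    moreover have "a \<le> stage (f z)" "stage (f z') \<le> b"
      using z(1,2) time that(2) by blast+
    ultimately have "carried a b j (f z)"
      by (rule carried_mono)
    then show ?thesis
      using z(1) by blast
  qed
  have *: "\<exists>z\<in>{..<m} \<times> {..<m}. fst z = x \<and> carried a b j (f z)"
    if "x \<in> mixed_rows m S" for x
    using that cross[of "Pair x ` {..<m}"] row[of x]
    by (fastforce simp: mixed_rows_def image_image)
  have **: "\<exists>z\<in>{..<m} \<times> {..<m}. snd z = y \<and> carried a b j (f z)"
    if "y \<in> mixed_columns m S" for y
    using that cross[of "(\<lambda>x. (x, y)) ` {..<m}"] col[of y]
    by (fastforce simp: mixed_columns_def image_image)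
  have main: "card X \<le> 2 * traffic a b"
    if X: "\<And>x. x \<in> X \<Longrightarrow> \<exists>z\<in>{..<m} \<times> {..<m}. c z = x \<and> carried a b j (f z)"
    for X and c :: "nat \<times> nat \<Rightarrow> nat"
  proof -
    obtain g where g: "\<And>x. x \<in> X \<Longrightarrow> g x \<in> {..<m} \<times> {..<m} \<and> c (g x) = x \<and>
        carried a b j (f (g x))"
      using X by metis
    have "inj_on (f \<circ> g) X"
    proof (rule inj_onI)
      fix x y assume xy: "x \<in> X" "y \<in> X" "(f \<circ> g) x = (f \<circ> g) y"
      then have "g x = g y"
        using inj_onD[OF inj, of "g x" "g y"] g by simp
      then show "x = y"
        using g xy(1,2) by metis
    qed
    then have "card X = card ((f \<circ> g) ` X)"
      by (rule card_image[symmetric])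
    also have "\<dots> \<le> 2 * traffic a b"
      using g by (intro card_carried_le_traffic[OF j]) auto
    finally show ?thesis .
  qed
  have "m \<le> 3 * card (mixed_rows m S) \<or> m \<le> 3 * card (mixed_columns m S)"
    using lower upper by (intro grid_isoperimetry) (auto simp: S_def)
  then show ?thesis
    using main[of "mixed_rows m S" fst, OF *] main[of "mixed_columns m S" snd, OF **] by auto
qed

lemma work_eq_card_hosted: "work j ex = card (hosted j)"
proof -
  let ?es = "filter (\<lambda>e. fst e = j) (all_evals ex)"
  have all: "set (all_evals ex) = (\<lambda>u. (host u, u)) ` stencil_nodes n"
  proof (intro equalityI subsetI)
    fix e assume "e \<in> set (all_evals ex)"
    then obtain x where "x \<in> set ex" "e \<in> set (evals x)"
      by (auto simp: all_evals_def)
    then obtain s where "s < length ex" "e \<in> set (evals (ex ! s))"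
      by (metis in_set_conv_nth)
    then show "e \<in> (\<lambda>u. (host u, u)) ` stencil_nodes n"
      using eval_unique[of s "fst e" "snd e"] by (cases e) auto
  next
    fix e assume "e \<in> (\<lambda>u. (host u, u)) ` stencil_nodes n"
    then show "e \<in> set (all_evals ex)"
      using evaluated nth_mem by (fastforce simp: all_evals_def)
  qed
  have "distinct (all_evals ex)"
    using once by (simp add: no_recomputation_def distinct_map)
  then have "work j ex = card (set ?es)"
    unfolding work_def by (intro distinct_card[symmetric] distinct_filter)
  also have "set ?es = (\<lambda>u. (host u, u)) ` hosted j"
    using all by (auto simp: hosted_def)
  also have "card \<dots> = card (hosted j)"
    by (intro card_image) (auto simp: inj_on_def)
  finally show ?thesis .
qed

lemma host_less:
  assumes "u \<in> stencil_nodes n" shows "host u < p"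
  using solves evaluated[OF assms] nth_mem unfolding solves_stencil_def well_formed_def by fastforce

end

section \<open>The whole DAG as a grid of connected lines\<close>

lemma zigzag_nodes:
  fixes n z i :: nat
  assumes "even n" "z < n" "i < n"
  shows "(if even z then z + i mod 2 else z - i mod 2) < n"
proof -
  have "z + i mod 2 < n" if "even z"
  proof -
    have "Suc z \<noteq> n"
      using that assms(1) by auto
    moreover have "i mod 2 \<le> 1"
      by simp
    ultimately show ?thesis
      using assms(2) by linarith
  qed
  then show ?thesis
    using assms by auto
qed

text \<open>For fixed \<open>z\<close> this is a path of arcs that runs between two adjacent rows of the DAG; the
  \<open>n\<close> paths partition the nodes if \<open>n\<close> is even.\<close>

definition zigzag :: "nat \<times> nat \<Rightarrow> node" where
  "zigzag = (\<lambda>(z, i). (i, if even z then z + i mod 2 else z - i mod 2))"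

lemma inj_zigzag: "inj zigzag"
proof (rule injI)
  fix a b assume *: "zigzag a = zigzag b"
  obtain z i z' i' where ab: "a = (z, i)" "b = (z', i')"
    by (metis surj_pair)
  have i: "i = i'"
    using * by (simp add: zigzag_def ab)
  have "z = z'"
  proof (cases "even i")
    case False
    then have i1: "i' mod 2 = 1"
      using i by presburger
    then have "(if even z then z + 1 else z - 1) = (if even z' then z' + 1 else z' - 1)"
      using * unfolding ab zigzag_def i by (simp add: i1 split: if_splits)
    then show ?thesis
      by (cases "even z"; cases "even z'"; simp; presburger)
  qed (use * i in \<open>auto simp: zigzag_def ab even_iff_mod_2_eq_zero split: if_splits\<close>)
  then show "a = b"
    by (simp add: ab i)
qed

text \<open>Nodes with equal second coordinate have no arcs between them, so a zigzag through two
  adjacent rows takes the place of a row. Its second coordinate changes at every step, hence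
  consecutive nodes are joined by an arc in one of the two directions.\<close>

lemma linked_zigzag:
  assumes "even n" "z < n"
  shows "linked n ((\<lambda>i. zigzag (z, i)) ` {..<n})"
proof (rule linked_path)
  fix i assume i: "Suc i < n"
  have "z > 0" if "odd z"
    using that by (cases z) auto
  then have "snd (zigzag (z, Suc i)) = Suc (snd (zigzag (z, i))) \<or>
      snd (zigzag (z, i)) = Suc (snd (zigzag (z, Suc i)))"
    by (auto simp: zigzag_def mod_Suc)
  then show "stencil_arc n (zigzag (z, i)) (zigzag (z, Suc i)) \<or>
      stencil_arc n (zigzag (z, Suc i)) (zigzag (z, i))"
    using zigzag_nodes[OF assms, of i] zigzag_nodes[OF assms, of "Suc i"] i
    by (auto simp: stencil_arc_def zigzag_def stencil_nodes_def)
qed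

text \<open>For fixed \<open>i\<close>, \<open>zigzag\<close> permutes the column by swapping
  neighbors or not at all, so its columns are columns of the DAG and \<open>linked_column\<close>
  applies.\<close>

lemma zigzag_column:
  assumes "even n" "i < n"
  shows "(\<lambda>z. zigzag (z, i)) ` {..<n} = Pair i ` {..<n}"
proof (rule card_subset_eq)
  show "(\<lambda>z. zigzag (z, i)) ` {..<n} \<subseteq> Pair i ` {..<n}"
    using zigzag_nodes[OF assms(1) _ assms(2)] by (auto simp: zigzag_def)
  have "card ((\<lambda>z. zigzag (z, i)) ` {..<n}) = n"
    using inj_zigzag by (subst card_image) (auto simp: inj_on_def)
  moreover have "card (Pair i ` {..<n}) = n"
    by (subst card_image) (auto simp: inj_on_def)
  ultimately show "card ((\<lambda>z. zigzag (z, i)) ` {..<n}) = card (Pair i ` {..<n})"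
    by simp
qed simp

lemma linked_column: "i < n \<Longrightarrow> linked n (Pair i ` {..<n})"
  by (rule linked_path) (auto simp: stencil_arc_def stencil_nodes_def)

lemma zigzag_square: 
  assumes "even n" shows "zigzag ` ({..<n} \<times> {..<n}) = stencil_nodes n"
proof (rule card_subset_eq)
  show "zigzag ` ({..<n} \<times> {..<n}) \<subseteq> stencil_nodes n"
    using zigzag_nodes[OF assms] by (auto simp: zigzag_def stencil_nodes_def)
  show "card (zigzag ` ({..<n} \<times> {..<n})) = card (stencil_nodes n)"
    using inj_zigzag by (subst card_image) (auto simp: stencil_nodes_def inj_on_def)
qed (simp add: stencil_nodes_def)

text \<open>The nodes \<open>diamond m (x, y)\<close> with \<open>x, y < m\<close> form a rotated square, on which every
  increment of one coordinate follows an arc.\<close>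

definition diamond :: "nat \<Rightarrow> nat \<times> nat \<Rightarrow> node" where
  "diamond m = (\<lambda>(x, y). (x + (m - 1) - y, x + y))"

lemma diamond_arc:
  assumes "2 * m \<le> n" "x < m" "y < m"
  shows "Suc x < m \<Longrightarrow> stencil_arc n (diamond m (x, y)) (diamond m (Suc x, y))"
    and "Suc y < m \<Longrightarrow> stencil_arc n (diamond m (x, y)) (diamond m (x, Suc y))"
  using assms by (auto simp: diamond_def stencil_arc_def stencil_nodes_def)

lemma inj_on_diamond: "inj_on (diamond m) ({..<m} \<times> {..<m})"
  by (auto simp: inj_on_def diamond_def)

lemma diamond_nodes: "2 * m \<le> n \<Longrightarrow> x < m \<Longrightarrow> y < m \<Longrightarrow> diamond m (x, y) \<in> stencil_nodes n"
  by (auto simp: diamond_def stencil_nodes_def)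

section \<open>Traffic inside a diamond and in the whole DAG\<close>

context stencil_run
begin

text \<open>Increments of either coordinate follow arcs, and \<open>stage\<close> never decreases
  along an arc.\<close>

lemma stage_diamond_mono:
  assumes "2 * m \<le> n" "x \<le> x'" "y \<le> y'" "x' < m" "y' < m"
  shows "stage (diamond m (x, y)) \<le> stage (diamond m (x', y'))"
proof -
  have "stage (diamond m (x, y)) \<le> stage (diamond m (x', y))"
    using assms(2,4)
  proof (induction x' rule: dec_induct)
    case (step k)
    then show ?case
      using arc_stage(1)[OF diamond_arc(1)[OF assms(1), of k y]] assms by auto
  qed simp
  also have "\<dots> \<le> stage (diamond m (x', y'))"
    using assms(3,5)
  proof (induction y' rule: dec_induct)
    case (step k)
    then show ?case
      using arc_stage(1)[OF diamond_arc(2)[OF assms(1), of x' k]] assms by auto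
  qed simp
  finally show ?thesis .
qed

text \<open>Induction with the invariant that no processing element has more than half of the
  subgrid. A single cell contradicts it. In a larger grid a share of at least an eighth is handled
  by \<open>grid_traffic\<close>, as half is below \<open>3 / 4\<close>; otherwise the invariant
  passes to two opposite quadrants.\<close>

lemma diamond_traffic:
  assumes "2 * m \<le> n" "x0 + 2 ^ k \<le> m" "y0 + 2 ^ k \<le> m"
    and "\<And>j. j < p \<Longrightarrow> 2 * card {(x, y) \<in> {..<2 ^ k} \<times> {..<2 ^ k}.
           host (diamond m (x0 + x, y0 + y)) = j} \<le> (2 ^ k)\<^sup>2"
    and "a \<le> stage (diamond m (x0, y0))"
    and "stage (diamond m (x0 + 2 ^ k - 1, y0 + 2 ^ k - 1)) \<le> b"
  shows "2 ^ k \<le> 6 * traffic a b"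
  using assms(2-)
proof (induction k arbitrary: x0 y0 a b)
  case 0
  let ?j = "host (diamond m (x0, y0))"
  have "?j < p"
    using 0 assms(1) by (intro host_less diamond_nodes) auto
  moreover have "{(x, y) \<in> {..<2 ^ 0} \<times> {..<2 ^ 0}. host (diamond m (x0 + x, y0 + y)) = ?j} = {(0, 0)}"
    by auto
  ultimately show ?case
    using 0(3)[of ?j] by simp
next
  case (Suc k)
  define l :: nat where "l = 2 ^ k"
  have l: "l > 0" "2 ^ Suc k = 2 * l"
    by (simp_all add: l_def)
  let ?f = "\<lambda>(x, y). diamond m (x0 + x, y0 + y)"
  define part where
    "part j = {(x, y) \<in> {..<2 * l} \<times> {..<2 * l}. host (diamond m (x0 + x, y0 + y)) = j}" for j
  note prems = Suc.prems[unfolded l]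
  have fin: "finite (part j)" for j
    unfolding part_def by (rule finite_subset[of _ "{..<2 * l} \<times> {..<2 * l}"]) auto
  show ?case
  proof (cases "\<exists>j<p. (2 * l)\<^sup>2 \<le> 8 * card (part j)")
    case True
    then obtain j where j: "j < p" "(2 * l)\<^sup>2 \<le> 8 * card (part j)"
      by blast
    have part: "{z \<in> {..<2 * l} \<times> {..<2 * l}. host (?f z) = j} = part j"
      by (auto simp: part_def)
    have "2 * l \<le> 6 * traffic a b"
    proof (rule grid_traffic[OF j(1), where f = ?f])
      show "inj_on ?f ({..<2 * l} \<times> {..<2 * l})"
        using prems(1,2) by (auto simp: inj_on_def dest!: inj_onD[OF inj_on_diamond])
      show "?f z \<in> stencil_nodes n" if "z \<in> {..<2 * l} \<times> {..<2 * l}" for z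
        using that prems(1,2) assms(1) by (auto intro!: diamond_nodes)
      show "linked n ((\<lambda>y. ?f (x, y)) ` {..<2 * l})" if "x < 2 * l" for x
      proof (rule linked_path)
        fix y assume "Suc y < 2 * l"
        then show "stencil_arc n (?f (x, y)) (?f (x, Suc y)) \<or> stencil_arc n (?f (x, Suc y)) (?f (x, y))"
          using that prems(1,2) diamond_arc(2)[OF assms(1), of "x0 + x" "y0 + y"] by simp
      qed
      show "linked n ((\<lambda>x. ?f (x, y)) ` {..<2 * l})" if "y < 2 * l" for y
      proof (rule linked_path)
        fix x assume "Suc x < 2 * l"
        then show "stencil_arc n (?f (x, y)) (?f (Suc x, y)) \<or> stencil_arc n (?f (Suc x, y)) (?f (x, y))"
          using that prems(1,2) diamond_arc(1)[OF assms(1), of "x0 + x" "y0 + y"] by simp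
      qed
      show "a \<le> stage (?f z) \<and> stage (?f z) \<le> b" if z: "z \<in> {..<2 * l} \<times> {..<2 * l}" for z
      proof -
        obtain x y where xy: "z = (x, y)" "x < 2 * l" "y < 2 * l"
          using z by auto
        have "stage (diamond m (x0, y0)) \<le> stage (diamond m (x0 + x, y0 + y))"
          "stage (diamond m (x0 + x, y0 + y)) \<le> stage (diamond m (x0 + 2 * l - 1, y0 + 2 * l - 1))"
          using xy prems(1,2) l by (intro stage_diamond_mono[OF assms(1)]; linarith)+
        then show ?thesis
          using prems(4,5) xy by auto
      qed
      show "(2 * l)\<^sup>2 \<le> 8 * card {z \<in> {..<2 * l} \<times> {..<2 * l}. host (?f z) = j}"
        unfolding part by (rule j(2))
      show "4 * card {z \<in> {..<2 * l} \<times> {..<2 * l}. host (?f z) = j} \<le> 3 * (2 * l)\<^sup>2"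
        unfolding part using prems(3)[OF j(1)] by (simp add: part_def)
    qed
    then show ?thesis
      by (simp only: l)
  next
    case False
    \<comment> \<open>A quadrant has a quarter of the area, so less than an eighth of the grid is
      less than half of the quadrant.\<close>
    have small: "2 * card {(x, y) \<in> {..<2 ^ k} \<times> {..<2 ^ k}.
        host (diamond m (x0 + s + x, y0 + s + y)) = j} \<le> (2 ^ k)\<^sup>2" (is "2 * card ?Q \<le> _")
      if "j < p" "s \<le> l" for j s
    proof -
      have "(\<lambda>(x, y). (s + x, s + y)) ` ?Q \<subseteq> part j"
        using that(2) by (auto simp: part_def l_def add.assoc)
      then have "card ((\<lambda>(x, y). (s + x, s + y)) ` ?Q) \<le> card (part j)"
        using fin by (intro card_mono)
      moreover have "card ((\<lambda>(x, y). (s + x, s + y)) ` ?Q) = card ?Q"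
        by (intro card_image) (auto simp: inj_on_def)
      moreover have "8 * card (part j) < (2 * l)\<^sup>2"
        using False that(1) by auto
      ultimately show ?thesis
        by (simp add: l_def power2_eq_square)
    qed
    \<comment> \<open>\<open>c\<close> is the stage of the last node of the first quadrant. It is at
      most the stage of the first node of the last quadrant, so the ranges from \<open>a\<close> to
      \<open>c\<close> and from \<open>c\<close> to \<open>b\<close> serve the two quadrants
      separately.\<close>
    define c where "c = stage (diamond m (x0 + l - 1, y0 + l - 1))"
    have "stage (diamond m (x0, y0)) \<le> c"
      unfolding c_def using prems(1,2) l(1) by (intro stage_diamond_mono[OF assms(1)]; linarith)
    then have ac: "a \<le> c"
      using prems(4) by linarith
    have cc: "c \<le> stage (diamond m (x0 + l, y0 + l))"
      unfolding c_def using prems(1,2) l(1) by (intro stage_diamond_mono[OF assms(1)]; linarith)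
    have "stage (diamond m (x0 + l, y0 + l)) \<le> stage (diamond m (x0 + 2 * l - 1, y0 + 2 * l - 1))"
      using prems(1,2) l(1) by (intro stage_diamond_mono[OF assms(1)]; linarith)
    then have cb: "stage (diamond m (x0 + l, y0 + l)) \<le> b"
      using prems(5) by linarith
    have "2 ^ k \<le> 6 * traffic a c"
      using prems small[of _ 0] l by (intro Suc.IH) (auto simp: c_def l_def)
    moreover have "2 ^ k \<le> 6 * traffic c b"
      using prems small[of _ l] l cc by (intro Suc.IH[of "x0 + l" "y0 + l"]) (auto simp: l_def mult_2 add.assoc)
    moreover have "traffic a b = traffic a c + traffic c b"
      using ac cc cb by (simp add: traffic_def sum.atLeastLessThan_concat)
    ultimately show ?thesis
      by simp
  qed
qed

text \<open>If some processing element has an eighth of the DAG, the zigzag grid suffices. Otherwise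
  every one has less than \<open>n\<^sup>2 / 8 = m\<^sup>2 / 2\<close> nodes with
  \<open>m = n / 2\<close>, which is the invariant of \<open>diamond_traffic\<close> for the diamond
  of side \<open>m\<close>; halving the side turns 6 into 12.\<close>

lemma traffic_lower_bound:
  assumes n: "n = 2 ^ Suc k" and work: "\<And>j. j < p \<Longrightarrow> 4 * work j ex \<le> 3 * n\<^sup>2"
  shows "n \<le> 12 * traffic 0 (length ex)"
proof (cases "\<exists>j<p. n\<^sup>2 \<le> 8 * card (hosted j)")
  case True
  then obtain j where j: "j < p" "n\<^sup>2 \<le> 8 * card (hosted j)"
    by blast
  have even: "even n"
    by (simp add: n)
  have "hosted j = zigzag ` {z \<in> {..<n} \<times> {..<n}. host (zigzag z) = j}"
    unfolding hosted_def zigzag_square[OF even, symmetric] by auto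
  then have part: "card {z \<in> {..<n} \<times> {..<n}. host (zigzag z) = j} = card (hosted j)"
    using inj_zigzag by (simp add: card_image inj_on_def inj_def)
  have "n \<le> 6 * traffic 0 (length ex)"
  proof (rule grid_traffic[OF j(1), where f = zigzag])
    show "inj_on zigzag ({..<n} \<times> {..<n})"
      using inj_zigzag by (simp add: inj_on_def inj_def)
    show nodes: "zigzag z \<in> stencil_nodes n" if "z \<in> {..<n} \<times> {..<n}" for z
      using that zigzag_square[OF even] by auto
    show "linked n ((\<lambda>i. zigzag (z, i)) ` {..<n})" if "z < n" for z
      using linked_zigzag[OF even that] .
    show "linked n ((\<lambda>z. zigzag (z, i)) ` {..<n})" if "i < n" for i
      using linked_column that zigzag_column[OF even that] by simp
    show "0 \<le> stage (zigzag z) \<and> stage (zigzag z) \<le> length ex"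
      if "z \<in> {..<n} \<times> {..<n}" for z
      using evaluated(1)[OF nodes[OF that]] by simp
    show "n\<^sup>2 \<le> 8 * card {z \<in> {..<n} \<times> {..<n}. host (zigzag z) = j}"
      unfolding part by (rule j(2))
    show "4 * card {z \<in> {..<n} \<times> {..<n}. host (zigzag z) = j} \<le> 3 * n\<^sup>2"
      unfolding part using work[OF j(1)] by (simp add: work_eq_card_hosted)
  qed
  then show ?thesis
    by simp
next
  case False
  define m :: nat where "m = 2 ^ k"
  have m: "n = 2 * m" "m > 0"
    by (simp_all add: n m_def)
  have "2 ^ k \<le> 6 * traffic 0 (length ex)"
  proof (rule diamond_traffic[of m 0 k 0])
    show "2 * card {(x, y) \<in> {..<2 ^ k} \<times> {..<2 ^ k}. host (diamond m (0 + x, 0 + y)) = j} \<le> (2 ^ k)\<^sup>2"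
      (is "2 * card ?Q \<le> _") if "j < p" for j
    proof -
      have "diamond m ` ?Q \<subseteq> hosted j"
      proof (rule image_subsetI)
        fix z assume "z \<in> ?Q"
        then obtain x y where "z = (x, y)" "x < m" "y < m" "host (diamond m (x, y)) = j"
          by (auto simp: m_def)
        then show "diamond m z \<in> hosted j"
          using diamond_nodes[of m n x y] m(1) unfolding hosted_def by simp
      qed
      then have "card (diamond m ` ?Q) \<le> card (hosted j)"
        by (intro card_mono) (auto simp: hosted_def stencil_nodes_def)
      moreover have "card (diamond m ` ?Q) = card ?Q"
        by (intro card_image inj_on_subset[OF inj_on_diamond]) (auto simp: m_def)
      moreover have "8 * card (hosted j) < n\<^sup>2"
        using False that by auto
      ultimately show ?thesis
        by (simp add: m m_def power2_eq_square)
    qed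
    show "stage (diamond m (0 + 2 ^ k - 1, 0 + 2 ^ k - 1)) \<le> length ex"
      using m evaluated(1)[of "diamond m (m - 1, m - 1)"] diamond_nodes[of m n "m - 1" "m - 1"]
      by (simp add: m_def)
  qed (use m in \<open>auto simp: m_def\<close>)
  then show ?thesis
    by (simp add: m m_def)
qed

text \<open>Its clusters are single processing elements, so every message stays where it is. Hence
  \<open>traffic\<close>, which sums over all entries, counts only charged supersteps.\<close>

lemma uncharged_superstep:
  assumes "s \<in> set ex" "floor_log p \<le> label s" "p > 0"
  shows "superstep_degree p s = 0"
proof -
  have "src m = dst m" if "m \<in> set (msgs s)" for m
    using solves assms that unfolding solves_stencil_def well_formed_def
    by (auto simp: same_cluster_def)
  then have "sent j s = 0" "received j s = 0" for j
    by (auto simp: sent_def received_def filter_empty_conv)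
  then have "(\<lambda>j. max (sent j s) (received j s)) ` {..<p} = {0}"
    using assms(3) by auto
  then show ?thesis
    by (simp add: superstep_degree_def)
qed

lemma traffic_le_comm_complexity:
  assumes "p > 0" "\<sigma> \<ge> 0"
  shows "real (traffic 0 (length ex)) \<le> comm_complexity p \<sigma> ex"
proof -
  have "real (traffic 0 (length ex)) = (\<Sum>s\<leftarrow>ex. real (superstep_degree p s))"
    by (simp add: traffic_def sum_list_sum_nth)
  also have "\<dots> \<le> comm_complexity p \<sigma> ex"
    unfolding comm_complexity_eq
    by (intro sum_list_mono) (use assms uncharged_superstep in \<open>auto simp: not_less\<close>)
  finally show ?thesis .
qed

end

lemma comm_complexity_lower_bound:
  assumes "stencil_class (3 / 4) n p B" "2 \<le> n" "is_pow2 n" "x \<in> inputs n" "\<sigma> \<ge> 0"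
  shows "real n \<le> 12 * comm_complexity p \<sigma> (B x)"
proof -
  have B: "is_pow2 p" "solves_stencil n p (B x)" "no_recomputation (B x)"
    "\<And>j. j < p \<Longrightarrow> real (work j (B x)) \<le> 3 / 4 * real n ^ 2"
    using assms(1,4) by (auto elim: stencil_class.cases)
  interpret stencil_run n p "B x"
    using B by unfold_locales
  obtain k where k: "n = 2 ^ Suc k"
    using assms(2,3) unfolding is_pow2_def by (metis not_less_eq_eq not0_implies_Suc
      numeral_2_eq_2 power_0 One_nat_def le_refl)
  have "4 * work j (B x) \<le> 3 * n\<^sup>2" if "j < p" for j
  proof -
    have "real (4 * work j (B x)) \<le> real (3 * n\<^sup>2)"
      using B(4)[OF that] by simp
    then show ?thesis
      by (simp only: of_nat_le_iff)
  qed
  then have "real n \<le> 12 * real (traffic 0 (length (B x)))"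
    using traffic_lower_bound[OF k] by (metis of_nat_le_iff of_nat_mult of_nat_numeral)
  moreover have "p > 0"
    using B(1) by (auto simp: is_pow2_def)
  ultimately show ?thesis
    using traffic_le_comm_complexity[of \<sigma>] assms(5) by fastforce
qed

section \<open>Folding\<close>

lemma div_eq_mono:
  fixes x y :: nat
  assumes "x div 2 ^ e = y div 2 ^ e" "e \<le> f"
  shows "x div 2 ^ f = y div 2 ^ f"
proof -
  have "z div 2 ^ f = z div 2 ^ e div 2 ^ (f - e)" for z :: nat
    using assms(2) by (simp add: div_mult2_eq[symmetric] power_add[symmetric])
  then show ?thesis
    using assms(1) by simp
qed

lemma pow2_div: "b \<le> a \<Longrightarrow> (2 :: nat) ^ a div 2 ^ b = 2 ^ (a - b)"
  by (simp add: power_diff)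

lemma label_fold [simp]: "label (fold_superstep v p s) = label s"
  by (simp add: fold_superstep_def)

lemma evals_fold: "evals (fold_superstep v p s) = map (\<lambda>(j, w). (j div (v div p), w)) (evals s)"
  by (simp add: fold_superstep_def)

lemma msgs_fold:
  "msgs (fold_superstep v p s) =
    map (\<lambda>m. m\<lparr>src := src m div (v div p), dst := dst m div (v div p)\<rparr>) (msgs s)"
  by (simp add: fold_superstep_def)

lemma all_evals_fold:
  "all_evals (map (fold_superstep v p) ex) = map (\<lambda>(j, w). (j div (v div p), w)) (all_evals ex)"
  by (simp add: all_evals_def map_concat evals_fold comp_def)

lemma snd_all_evals_fold: "map snd (all_evals (map (fold_superstep v p) ex)) = map snd (all_evals ex)"
  by (simp add: all_evals_fold case_prod_unfold comp_def)

text \<open>Merging processing elements can only enlarge what each of them holds.\<close>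

lemma evals_ok_fold:
  assumes "evals_ok n K es" "\<And>j u. (j, u) \<in> K \<Longrightarrow> (j div d, u) \<in> K'"
  shows "evals_ok n K' (map (\<lambda>(j, w). (j div d, w)) es)"
  using assms
proof (induction n K es arbitrary: K' rule: evals_ok.induct)
  case (2 n K j w es)
  have "evals_ok n (insert (j div d, w) K') (map (\<lambda>(j, w). (j div d, w)) es)"
    using 2 by (intro "2.IH") auto
  then show ?case
    using 2 by simp
qed simp

lemma execution_ok_fold:
  assumes "execution_ok n K ex" "\<And>j u. (j, u) \<in> K \<Longrightarrow> (j div (v div p), u) \<in> K'"
  shows "execution_ok n K' (map (fold_superstep v p) ex)"
  using assms
proof (induction n K ex arbitrary: K' rule: execution_ok.induct)
  case (2 n K s ss)
  let ?s = "fold_superstep v p s"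
  have E: "(j div (v div p), u) \<in> K' \<union> set (evals ?s)"
    if "(j, u) \<in> K \<union> set (evals s)" for j u
    using that
  proof
    assume "(j, u) \<in> set (evals s)"
    then show ?thesis
      by (intro UnI2) (simp add: evals_fold rev_image_eqI)
  qed (use 2(3) in simp)
  have D: "(j div (v div p), u) \<in> delivered (msgs ?s)" if "(j, u) \<in> delivered (msgs s)" for j u
  proof -
    from that obtain m where m: "m \<in> set (msgs s)" "dst m = j" "payload m = Some u"
      by (auto simp: delivered_def)
    define m' where "m' = m\<lparr>src := src m div (v div p), dst := dst m div (v div p)\<rparr>"
    have "m' \<in> set (msgs ?s)" "dst m' = j div (v div p)" "payload m' = Some u"
      using m by (auto simp: m'_def msgs_fold)
    then show ?thesis
      unfolding delivered_def by (intro CollectI exI[of _ m'] exI[of _ u]) simp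
  qed
  have "evals_ok n K' (evals ?s)"
    unfolding evals_fold using 2(2,3) by (intro evals_ok_fold) auto
  moreover have "msgs_ok (K' \<union> set (evals ?s)) (msgs ?s)"
    unfolding msgs_ok_def
  proof (intro ballI allI impI)
    fix m' u assume m': "m' \<in> set (msgs ?s)" "payload m' = Some u"
    then obtain m where m: "m \<in> set (msgs s)" "payload m = Some u" "src m' = src m div (v div p)"
      by (auto simp: msgs_fold)
    then have "(src m, u) \<in> K \<union> set (evals s)"
      using 2(2) unfolding execution_ok.simps msgs_ok_def by blast
    then show "(src m', u) \<in> K' \<union> set (evals ?s)"
      unfolding m(3) by (rule E)
  qed
  moreover have "execution_ok n (K' \<union> set (evals ?s) \<union> delivered (msgs ?s)) (map (fold_superstep v p) ss)"
    using 2(2) E D by (intro "2.IH") auto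
  ultimately show ?case
    by simp
qed simp

text \<open>A common cluster of the large machine is mapped into a common cluster of the small one.
  If the label is at least \<open>b\<close>, the truncated difference \<open>b - i\<close> is
  \<open>0\<close> and the whole cluster collapses to one processing element.\<close>

lemma well_formed_fold:
  assumes "well_formed (2 ^ a) ex" "b \<le> a"
  shows "well_formed (2 ^ b) (map (fold_superstep (2 ^ a) (2 ^ b)) ex)"
proof -
  have less: "x div 2 ^ (a - b) < 2 ^ b" if "x < 2 ^ a" for x :: nat
    using that assms(2) by (simp add: less_mult_imp_div_less power_add[symmetric])
  have cluster: "same_cluster (2 ^ b) i (x div 2 ^ (a - b)) (y div 2 ^ (a - b))"
    if "same_cluster (2 ^ a) i x y" for i x y
  proof -
    have "x div 2 ^ (a - b + (b - i)) = y div 2 ^ (a - b + (b - i))"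
    proof (rule div_eq_mono)
      show "x div 2 ^ (a - i) = y div 2 ^ (a - i)"
        using that by (simp add: same_cluster_def)
      show "a - i \<le> a - b + (b - i)"
        using assms(2) by simp
    qed
    then show ?thesis
      by (simp add: same_cluster_def power_add div_mult2_eq)
  qed
  show ?thesis
    using assms(1) less cluster
    by (auto simp: well_formed_def evals_fold msgs_fold pow2_div[OF assms(2)] case_prod_unfold)
qed

lemma solves_stencil_fold:
  assumes "solves_stencil n (2 ^ a) ex" "b \<le> a"
  shows "solves_stencil n (2 ^ b) (map (fold_superstep (2 ^ a) (2 ^ b)) ex)"
proof -
  have "snd ` set (all_evals (map (fold_superstep (2 ^ a) (2 ^ b)) ex)) = snd ` set (all_evals ex)"
    by (metis list.set_map snd_all_evals_fold)
  then show ?thesis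
    using assms unfolding solves_stencil_def
    by (auto intro: well_formed_fold execution_ok_fold[where K = "{}"])
qed

lemma no_recomputation_fold:
  "no_recomputation (map (fold_superstep v p) ex) = no_recomputation ex"
  by (simp add: no_recomputation_def snd_all_evals_fold)

lemma work_fold:
  "work j (map (fold_superstep v p) ex) =
    length (filter (\<lambda>e. fst e div (v div p) = j) (all_evals ex))"
  by (simp add: work_def all_evals_fold filter_map comp_def case_prod_unfold)

lemma fold_superstep_id: "p > 0 \<Longrightarrow> fold_superstep p p s = s"
  by (simp add: fold_superstep_def)

text \<open>Folding twice is folding once, which resolves the recursion in
  \<open>stencil_class\<close>.\<close>

lemma fold_superstep_fold:
  assumes "c \<le> b" "b \<le> a"
  shows "fold_superstep (2 ^ b) (2 ^ c) (fold_superstep (2 ^ a) (2 ^ b) s) =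
    fold_superstep (2 ^ a) (2 ^ c) s"
proof -
  have "j div 2 ^ (a - b) div 2 ^ (b - c) = j div 2 ^ (a - c)" for j :: nat
    using assms by (simp add: div_mult2_eq[symmetric] power_add[symmetric])
  then show ?thesis
    using assms by (simp add: fold_superstep_def pow2_div case_prod_unfold comp_def)
qed

lemma stencil_class_fold:
  fixes ex :: execution
  assumes "solves_stencil n (2 ^ a) ex" "no_recomputation ex"
    and "\<And>b j. 1 \<le> b \<Longrightarrow> b \<le> a \<Longrightarrow> real (work j (map (fold_superstep (2 ^ a) (2 ^ b)) ex)) \<le> \<epsilon> * real n ^ 2"
    and "1 \<le> b" "b \<le> a"
  shows "stencil_class \<epsilon> n (2 ^ b) (fold_algorithm (2 ^ a) (2 ^ b) (\<lambda>_ :: 'v list. ex))"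
  using assms(4,5)
proof (induction b rule: less_induct)
  case (less b)
  show ?case
  proof (rule stencil_class.intros)
    show "is_pow2 (2 ^ b)"
      by (auto simp: is_pow2_def)
    show "\<forall>q'. is_pow2 q' \<and> 2 \<le> q' \<and> q' < 2 ^ b \<longrightarrow> stencil_class \<epsilon> n q'
        (fold_algorithm (2 ^ b) q' (fold_algorithm (2 ^ a) (2 ^ b) (\<lambda>_ :: 'v list. ex)))"
    proof (intro allI impI)
      fix q' :: nat assume q': "is_pow2 q' \<and> 2 \<le> q' \<and> q' < 2 ^ b"
      then obtain c where c: "q' = 2 ^ c" "2 \<le> q'" "q' < 2 ^ b"
        by (auto simp: is_pow2_def)
      have "1 \<le> c"
        using c(1,2) by (cases c) simp_all
      moreover have "c < b"
        using c(1,3) by simp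
      moreover from \<open>c < b\<close> have "fold_algorithm (2 ^ b) q' (fold_algorithm (2 ^ a) (2 ^ b) (\<lambda>_ :: 'v list. ex)) =
          fold_algorithm (2 ^ a) (2 ^ c) (\<lambda>_. ex)"
        using less.prems by (simp add: fold_algorithm_def c(1) comp_def fold_superstep_fold)
      ultimately show "stencil_class \<epsilon> n q'
          (fold_algorithm (2 ^ b) q' (fold_algorithm (2 ^ a) (2 ^ b) (\<lambda>_ :: 'v list. ex)))"
        using less by (simp add: c(1))
    qed
  qed (use assms(1-3) less.prems in
      \<open>auto simp: fold_algorithm_def static_on_def no_recomputation_fold solves_stencil_fold\<close>)
qed

section \<open>Degrees after folding\<close>

lemma length_filter_div_le:
  assumes "\<And>a :: nat. length (filter (\<lambda>m. f m = a) ms) \<le> D" "w > 0"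
  shows "length (filter (\<lambda>m. f m div w = j) ms) \<le> D * w"
proof -
  have "length (filter (\<lambda>m. f m div w = j) ms) = (\<Sum>a\<in>{j * w..<j * w + w}. length (filter (\<lambda>m. f m = a) ms))"
  proof (induction ms)
    case (Cons m ms)
    have "f m div w = j \<longleftrightarrow> f m \<in> {j * w..<j * w + w}"
      using div_nat_eqI[of w j "f m"] assms(2)
      by (auto simp: mult.commute dividend_less_div_times intro: div_times_less_eq_dividend)
        (metis add.commute dividend_less_div_times mult.commute)
    moreover have "(\<Sum>a\<in>{j * w..<j * w + w}. length (filter (\<lambda>m. f m = a) (m # ms))) =
      (\<Sum>a\<in>{j * w..<j * w + w}. length (filter (\<lambda>m. f m = a) ms)) +
      (\<Sum>a\<in>{j * w..<j * w + w}. if a = f m then 1 else 0)"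
      unfolding sum.distrib[symmetric] by (intro sum.cong) auto
    ultimately show ?case
      using Cons.IH by simp
  qed simp
  also have "\<dots> \<le> (\<Sum>a\<in>{j * w..<j * w + w}. D)"
    by (intro sum_mono assms(1))
  finally show ?thesis
    by (simp add: mult.commute)
qed

lemma superstep_degree_fold_le:
  assumes "\<And>a. length (filter (\<lambda>m. src m = a) (msgs s)) \<le> D"
    and "\<And>a. length (filter (\<lambda>m. dst m = a) (msgs s)) \<le> D"
    and "p > 0" "v div p > 0"
  shows "superstep_degree p (fold_superstep v p s) \<le> D * (v div p)"
proof -
  have mono: "length (filter P xs) \<le> length (filter Q xs)" if "\<And>x. P x \<Longrightarrow> Q x" for P Q :: "message \<Rightarrow> bool" and xs
    using that by (induction xs) auto
  have "sent j (fold_superstep v p s) \<le> D * (v div p)" for j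
  proof -
    have "sent j (fold_superstep v p s) =
        length (filter (\<lambda>m. src m div (v div p) = j \<and> dst m div (v div p) \<noteq> j) (msgs s))"
      by (simp add: sent_def msgs_fold filter_map comp_def)
    also have "\<dots> \<le> length (filter (\<lambda>m. src m div (v div p) = j) (msgs s))"
      by (rule mono) simp
    also have "\<dots> \<le> D * (v div p)"
      by (rule length_filter_div_le[OF assms(1,4)])
    finally show ?thesis .
  qed
  moreover have "received j (fold_superstep v p s) \<le> D * (v div p)" for j
  proof -
    have "received j (fold_superstep v p s) =
        length (filter (\<lambda>m. dst m div (v div p) = j \<and> src m div (v div p) \<noteq> j) (msgs s))"
      by (simp add: received_def msgs_fold filter_map comp_def)
    also have "\<dots> \<le> length (filter (\<lambda>m. dst m div (v div p) = j) (msgs s))"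
      by (rule mono) simp
    also have "\<dots> \<le> D * (v div p)"
      by (rule length_filter_div_le[OF assms(2,4)])
    finally show ?thesis .
  qed
  ultimately show ?thesis
    unfolding superstep_degree_def using assms(3) by (subst Max_le_iff) auto
qed

section \<open>Executions indexed by a sorted list of keys\<close>

lemma evals_ok_mono: "evals_ok n K es \<Longrightarrow> K \<subseteq> K' \<Longrightarrow> evals_ok n K' es"
proof (induction n K es arbitrary: K' rule: evals_ok.induct)
  case (2 n K j w es)
  have "evals_ok n (insert (j, w) K') es"
  proof (rule "2.IH")
    show "evals_ok n (insert (j, w) K) es"
      using "2.prems"(1) by simp
    show "insert (j, w) K \<subseteq> insert (j, w) K'"
      using "2.prems"(2) by (rule insert_mono)
  qed
  then show ?case
    using "2.prems" unfolding evals_ok.simps by blast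
qed simp

text \<open>All predecessors are held before the list starts, so the order of the evaluations does
  not matter.\<close>

lemma evals_okI:
  assumes "\<And>j w. (j, w) \<in> set es \<Longrightarrow> w \<in> stencil_nodes n"
    and "\<And>j w u. (j, w) \<in> set es \<Longrightarrow> stencil_arc n u w \<Longrightarrow> (j, u) \<in> K"
  shows "evals_ok n K es"
  using assms
proof (induction es)
  case (Cons e es)
  have "evals_ok n K es"
    using Cons by (meson list.set_intros(2))
  then have "evals_ok n (insert e K) es"
    by (rule evals_ok_mono) auto
  moreover obtain j w where e: "e = (j, w)"
    by (cases e)
  ultimately show ?case
    using Cons.prems[of j w] unfolding e evals_ok.simps by auto
qed simp

text \<open>With increasing keys, the supersteps executed before \<open>k\<close> are those with
  smaller keys. Correctness can thus be checked key by key.\<close>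

lemma execution_ok_map_sorted:
  fixes ks :: "nat list"
  assumes "sorted_wrt (<) ks"
    and "\<And>k. k \<in> set ks \<Longrightarrow> evals_ok n (K \<union> \<Union>(learned ` g ` {r \<in> set ks. r < k})) (evals (g k))"
    and "\<And>k. k \<in> set ks \<Longrightarrow>
      msgs_ok (K \<union> \<Union>(learned ` g ` {r \<in> set ks. r < k}) \<union> set (evals (g k))) (msgs (g k))"
  shows "execution_ok n K (map g ks)"
  using assms
proof (induction ks arbitrary: K)
  case (Cons k ks)
  have first: "{r \<in> set (k # ks). r < k} = {}"
    using Cons.prems(1) by auto
  have later: "K \<union> \<Union>(learned ` g ` {r \<in> set (k # ks). r < k'}) =
      K \<union> learned (g k) \<union> \<Union>(learned ` g ` {r \<in> set ks. r < k'})" if "k' \<in> set ks" for k'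
  proof -
    have "{r \<in> set (k # ks). r < k'} = insert k {r \<in> set ks. r < k'}"
      using Cons.prems(1) that by auto
    then show ?thesis
      by (simp add: Un_assoc)
  qed
  have "execution_ok n (K \<union> learned (g k)) (map g ks)"
  proof (rule Cons.IH)
    show "sorted_wrt (<) ks"
      using Cons.prems(1) by simp
  next
    fix k' assume k': "k' \<in> set ks"
    then have "k' \<in> set (k # ks)"
      by simp
    from Cons.prems(2)[OF this] Cons.prems(3)[OF this]
    show "evals_ok n (K \<union> learned (g k) \<union> \<Union>(learned ` g ` {r \<in> set ks. r < k'})) (evals (g k'))"
      "msgs_ok (K \<union> learned (g k) \<union> \<Union>(learned ` g ` {r \<in> set ks. r < k'}) \<union> set (evals (g k'))) (msgs (g k'))"
      unfolding later[OF k'] .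
  qed
  moreover have "K \<union> learned (g k) = K \<union> set (evals (g k)) \<union> delivered (msgs (g k))"
    by (auto simp: learned_def)
  ultimately show ?case
    using Cons.prems(2,3)[of k] unfolding first by simp
qed simp

section \<open>The algorithm\<close>

definition owner :: "node \<Rightarrow> nat" where
  "owner u = (fst u + snd u) div 2"

text \<open>The sum of the delays across the boundaries up to \<open>j\<close>: a boundary before
  \<open>i\<close> counts \<open>1\<close> for the summand \<open>j\<close> and \<open>2 ^ v\<close>
  for each \<open>v < L\<close> such that \<open>2 ^ v\<close> divides \<open>i\<close>, as
  \<open>j div 2 ^ v\<close> is the number of such \<open>i\<close> up to \<open>j\<close>.\<close>

definition delay :: "nat \<Rightarrow> nat \<Rightarrow> nat" where
  "delay L j = j + (\<Sum>v<L. 2 ^ v * (j div 2 ^ v))"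

text \<open>The time step in which \<open>u\<close> is evaluated: each processing element works
  through one row per time step, starting after its delay.\<close>

definition ready :: "nat \<Rightarrow> node \<Rightarrow> nat" where
  "ready L u = delay L (owner u) + snd u"

text \<open>The next processing element uses the value of \<open>u\<close> one time step later, for
  the row \<open>snd u + 1\<close>.\<close>

definition wanted :: "nat \<Rightarrow> node \<Rightarrow> nat" where
  "wanted L u = delay L (Suc (owner u)) + snd u"

text \<open>The values of row \<open>t\<close> that processing element \<open>j\<close> sends or receives are spread over the
  \<open>2 ^ v\<close> processing elements of its cluster.\<close>

definition slot :: "nat \<Rightarrow> nat \<Rightarrow> nat \<Rightarrow> nat" where
  "slot v j t = j div 2 ^ v * 2 ^ v + t mod 2 ^ v"

text \<open>This flips bit \<open>v\<close> of \<open>a\<close>.\<close>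

definition sibling :: "nat \<Rightarrow> nat \<Rightarrow> nat" where
  "sibling v a = (if even (a div 2 ^ v) then Suc (a div 2 ^ v) else a div 2 ^ v - 1) * 2 ^ v + a mod 2 ^ v"

definition node_list :: "nat \<Rightarrow> node list" where
  "node_list n = List.product [0..<n] [0..<n]"

text \<open>The dummy messages to the siblings make the superstep equally expensive for every
  processing element.\<close>

definition transfer :: "nat \<Rightarrow> nat \<Rightarrow> (node \<Rightarrow> bool) \<Rightarrow> (node \<Rightarrow> nat) \<Rightarrow> (node \<Rightarrow> nat) \<Rightarrow> superstep" where
  "transfer L v P f g = \<lparr>label = L - Suc v, evals = [],
     msgs = map (\<lambda>u. \<lparr>src = f u, dst = g u, payload = Some u\<rparr>) (filter P (node_list (2 ^ L))) @
       map (\<lambda>a. \<lparr>src = a, dst = sibling v a, payload = None\<rparr>) [0..<2 ^ L]\<rparr>"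

text \<open>The window for \<open>T\<close> contains exactly one multiple of
  \<open>2 ^ Suc v\<close>, so a value moves once on each level that it takes part in. The last
  processing element is left out since it has no successor.\<close>

definition collects :: "nat \<Rightarrow> nat \<Rightarrow> nat \<Rightarrow> node \<Rightarrow> bool" where
  "collects L v T u \<longleftrightarrow> 2 ^ v dvd Suc (owner u) \<and> Suc (owner u) < 2 ^ L \<and>
     ready L u < T \<and> T \<le> ready L u + 2 ^ Suc v"

definition collect_src :: "nat \<Rightarrow> node \<Rightarrow> nat" where
  "collect_src v u = slot v (owner u) (snd u)"

text \<open>If the boundary also ends a cluster of the next size, the value climbs to that cluster.
  Otherwise the clusters on both sides are siblings and the value crosses.\<close>

definition collect_dst :: "nat \<Rightarrow> node \<Rightarrow> nat" where
  "collect_dst v u = (if 2 ^ Suc v dvd Suc (owner u) then slot (Suc v) (owner u) (snd u)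
     else slot v (Suc (owner u)) (snd u))"

text \<open>The divisibility selects the values that crossed above level \<open>v\<close>. At the
  active time steps, the window makes \<open>T\<close> the time \<open>wanted L u\<close> rounded
  down to a multiple of \<open>2 ^ Suc v\<close>.\<close>

definition distributes :: "nat \<Rightarrow> nat \<Rightarrow> nat \<Rightarrow> node \<Rightarrow> bool" where
  "distributes L v T u \<longleftrightarrow> 2 ^ Suc v dvd Suc (owner u) \<and> Suc (owner u) < 2 ^ L \<and>
     T \<le> wanted L u \<and> wanted L u < T + 2 ^ Suc v"

definition distribute_src :: "nat \<Rightarrow> node \<Rightarrow> nat" where
  "distribute_src v u = slot (Suc v) (Suc (owner u)) (snd u)"

definition distribute_dst :: "nat \<Rightarrow> node \<Rightarrow> nat" where
  "distribute_dst v u = slot v (Suc (owner u)) (snd u)"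

text \<open>Before folding every entry has to be a superstep, so this local computation gets the
  finest label.\<close>

definition evaluation :: "nat \<Rightarrow> nat \<Rightarrow> superstep" where
  "evaluation L T = \<lparr>label = L - 1,
     evals = map (\<lambda>u. (owner u, u)) (filter (\<lambda>u. ready L u = T) (node_list (2 ^ L))), msgs = []\<rparr>"

text \<open>Time step \<open>T\<close> consists of the supersteps with keys \<open>T * (2 * L + 1) + k\<close>, \<open>k \<le> 2 * L\<close>.\<close>

definition key :: "nat \<Rightarrow> nat \<Rightarrow> nat \<Rightarrow> nat" where
  "key L T k = T * (2 * L + 1) + k"

text \<open>Levels ascend while collecting and descend while distributing, so that a value can move
  through several levels within one time step; evaluations come last.\<close>

definition schedule :: "nat \<Rightarrow> nat \<Rightarrow> superstep" where
  "schedule L N = (let T = N div (2 * L + 1); k = N mod (2 * L + 1) in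
     if k < L then transfer L k (collects L k T) (collect_src k) (collect_dst k)
     else if k < 2 * L then
       let v = 2 * L - 1 - k in transfer L v (distributes L v T) (distribute_src v) (distribute_dst v)
     else evaluation L T)"

text \<open>Supersteps of level \<open>v\<close> take place only every \<open>2 ^ Suc v\<close> time
  steps; for the distributing ones, \<open>2 * L - k\<close> is \<open>Suc v\<close>.\<close>

definition active :: "nat \<Rightarrow> nat \<Rightarrow> bool" where
  "active L N \<longleftrightarrow> (let T = N div (2 * L + 1); k = N mod (2 * L + 1) in
     if k < L then 2 ^ Suc k dvd T else if k < 2 * L then 2 ^ (2 * L - k) dvd T else True)"

definition horizon :: "nat \<Rightarrow> nat" where
  "horizon L = 2 ^ L * (L + 2)"

definition plan_keys :: "nat \<Rightarrow> nat list" where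
  "plan_keys L = filter (active L) [0..<horizon L * (2 * L + 1)]"

definition plan :: "nat \<Rightarrow> execution" where
  "plan L = map (schedule L) (plan_keys L)"

section \<open>Arithmetic of owners, delays, slots and keys\<close>

lemma set_node_list [simp]: "set (node_list n) = stencil_nodes n"
  by (auto simp: node_list_def stencil_nodes_def)

lemma distinct_node_list [simp]: "distinct (node_list n)"
  by (simp add: node_list_def distinct_product)

lemma owner_less: "u \<in> stencil_nodes n \<Longrightarrow> owner u < n"
  by (auto simp: owner_def stencil_nodes_def)

text \<open>Along an arc the sum of the coordinates grows by 0, 1 or 2, hence its half by at most
  1.\<close>

lemma arc_owner:
  assumes "stencil_arc n u w"
  shows "owner w = owner u \<or> owner w = Suc (owner u)" "snd w = Suc (snd u)"
proof -
  have "fst w + snd w \<in> {fst u + snd u, fst u + snd u + 1, fst u + snd u + 2}"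
    using assms by (auto simp: stencil_arc_def)
  then show "owner w = owner u \<or> owner w = Suc (owner u)"
    unfolding owner_def by (elim insertE emptyE; simp; linarith)
  show "snd w = Suc (snd u)"
    using assms by (simp add: stencil_arc_def)
qed

text \<open>The delay across the boundary between \<open>j\<close> and \<open>j + 1\<close> is the size of the smallest cluster
  that contains both.\<close>

lemma delay_Suc:
  assumes "v < L" "2 ^ v dvd Suc j" "\<not> 2 ^ Suc v dvd Suc j"
  shows "delay L (Suc j) = delay L j + 2 ^ Suc v"
proof -
  have dvd: "2 ^ i dvd Suc j \<longleftrightarrow> i \<le> v" for i
    using assms(2,3) by (meson dvd_trans le_imp_power_dvd not_less_eq_eq)
  have "2 ^ i * (Suc j div 2 ^ i) = 2 ^ i * (j div 2 ^ i) + (if i \<le> v then 2 ^ i else 0)" for i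
    using dvd[of i] by (simp add: div_Suc dvd_eq_mod_eq_0 algebra_simps)
  then have "(\<Sum>i<L. 2 ^ i * (Suc j div 2 ^ i)) =
      (\<Sum>i<L. 2 ^ i * (j div 2 ^ i)) + (\<Sum>i<L. if i \<le> v then 2 ^ i else 0)"
    by (simp add: sum.distrib)
  also have "(\<Sum>i<L. if i \<le> v then 2 ^ i else 0 :: nat) = (\<Sum>i<Suc v. 2 ^ i)"
    using assms(1) by (intro sum.mono_neutral_cong_right) auto
  \<comment> \<open>The missing 1 comes from the summand \<open>j\<close> of
    \<open>delay\<close>.\<close>
  also have "\<dots> = 2 ^ Suc v - 1"
    by (induction v) (auto simp: algebra_simps)
  finally show ?thesis
    by (simp add: delay_def)
qed

lemma delay_le: "delay L j \<le> j * (L + 1)"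
proof -
  have "(\<Sum>v<L. 2 ^ v * (j div 2 ^ v)) \<le> (\<Sum>v<L. j)"
    by (intro sum_mono) simp
  then show ?thesis
    by (simp add: delay_def mult.commute)
qed

lemma ready_less_horizon:
  assumes "u \<in> stencil_nodes (2 ^ L)"
  shows "ready L u < horizon L"
proof -
  have "delay L (owner u) \<le> 2 ^ L * (L + 1)"
    using delay_le[of L "owner u"] owner_less[OF assms] by (meson le_trans less_imp_le mult_le_mono1)
  moreover have "snd u < 2 ^ L"
    using assms by (auto simp: stencil_nodes_def)
  ultimately show ?thesis
    by (simp add: ready_def horizon_def algebra_simps)
qed

lemma slot_0 [simp]: "slot 0 j t = j"
  by (simp add: slot_def)

lemma slot_div: "slot v j t div 2 ^ v = j div 2 ^ v"
  by (simp add: slot_def)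

lemma slot_mod: "slot v j t mod 2 ^ v = t mod 2 ^ v"
  by (simp add: slot_def)

lemma slot_less:
  assumes "v \<le> L" "j < 2 ^ L" shows "slot v j t < 2 ^ L"
proof -
  have "slot v j t div 2 ^ L = j div 2 ^ L"
    using slot_div assms(1) by (rule div_eq_mono)
  then show ?thesis
    using assms(2) by (simp add: div_eq_0_iff)
qed

lemma sibling_div:
  "sibling v a div 2 ^ v = (if even (a div 2 ^ v) then Suc (a div 2 ^ v) else a div 2 ^ v - 1)"
  by (simp add: sibling_def)

lemma sibling_mod: "sibling v a mod 2 ^ v = a mod 2 ^ v"
  by (simp add: sibling_def)

lemma sibling_cluster: "sibling v a div 2 ^ Suc v = a div 2 ^ Suc v"
proof -
  have "(if even q then Suc q else q - 1) div 2 = q div 2" for q :: nat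
    by presburger
  then show ?thesis
    unfolding power_Suc2 div_mult2_eq sibling_div by simp
qed

lemma sibling_less:
  assumes "v < L" "a < 2 ^ L" shows "sibling v a < 2 ^ L"
proof -
  have "sibling v a div 2 ^ L = a div 2 ^ L"
    using sibling_cluster Suc_leI[OF assms(1)] by (rule div_eq_mono)
  then show ?thesis
    using assms(2) by (simp add: div_eq_0_iff)
qed

lemma sibling_neq:
  assumes "e \<le> v" shows "sibling v a div 2 ^ e \<noteq> a div 2 ^ e"
proof
  assume "sibling v a div 2 ^ e = a div 2 ^ e"
  then have "sibling v a div 2 ^ v = a div 2 ^ v"
    using assms by (rule div_eq_mono)
  moreover have "(if even q then Suc q else q - 1) \<noteq> q" for q :: nat
    by presburger
  ultimately show False
    by (simp add: sibling_div)
qed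

lemma inj_sibling: "inj (sibling v)"
proof (rule injI)
  fix a b assume *: "sibling v a = sibling v b"
  have eq: "q = r" if "(if even q then Suc q else q - 1) = (if even r then Suc r else r - 1)" for q r :: nat
    using that by presburger
  have "a div 2 ^ v = b div 2 ^ v"
    by (rule eq) (simp only: sibling_div[symmetric] *)
  moreover have "a mod 2 ^ v = b mod 2 ^ v"
    using * sibling_mod[of v a] sibling_mod[of v b] by simp
  ultimately show "a = b"
    by (metis div_mult_mod_eq)
qed

lemma key_div_mod:
  assumes "k \<le> 2 * L"
  shows "key L T k div (2 * L + 1) = T" "key L T k mod (2 * L + 1) = k"
proof -
  define M where "M = 2 * L + 1"
  then have "k < M"
    using assms by simp
  then have "(T * M + k) div M = T" "(T * M + k) mod M = k"
    by simp_all
  then show "key L T k div (2 * L + 1) = T" "key L T k mod (2 * L + 1) = k"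
    by (simp_all only: key_def M_def)
qed

lemma key_split:
  obtains T k where "N = key L T k" "k \<le> 2 * L"
proof
  show "N = key L (N div (2 * L + 1)) (N mod (2 * L + 1))"
    unfolding key_def by (rule div_mult_mod_eq[symmetric])
  have "N mod (2 * L + 1) < 2 * L + 1"
    by (rule mod_less_divisor) simp
  then show "N mod (2 * L + 1) \<le> 2 * L"
    by linarith
qed

lemma key_less:
  assumes "T' \<le> T" "k' \<le> 2 * L" "T' = T \<Longrightarrow> k' < k"
  shows "key L T' k' < key L T k"
proof (cases "T' = T")
  case False
  then have "Suc T' * (2 * L + 1) \<le> T * (2 * L + 1)"
    using assms(1) by (intro mult_le_mono1) simp
  then show ?thesis
    using assms(2) unfolding key_def mult_Suc by linarith
qed (use assms(3) in \<open>simp add: key_def\<close>)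

lemma key_less_horizon:
  assumes "k \<le> 2 * L" shows "key L T k < H * (2 * L + 1) \<longleftrightarrow> T < H"
proof
  assume less: "key L T k < H * (2 * L + 1)"
  show "T < H"
  proof (rule ccontr)
    assume "\<not> T < H"
    then have "H * (2 * L + 1) \<le> T * (2 * L + 1)"
      by (intro mult_le_mono1) simp
    then show False
      using less unfolding key_def by linarith
  qed
next
  assume "T < H"
  then show "key L T k < H * (2 * L + 1)"
    using key_less[of T H k L 0] assms by (simp add: key_def)
qed

lemma schedule_key_if:
  assumes "k \<le> 2 * L"
  shows "schedule L (key L T k) =
    (if k < L then transfer L k (collects L k T) (collect_src k) (collect_dst k)
     else if k < 2 * L then let v = 2 * L - 1 - k in
       transfer L v (distributes L v T) (distribute_src v) (distribute_dst v)
     else evaluation L T)"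
    and "active L (key L T k) \<longleftrightarrow>
    (if k < L then 2 ^ Suc k dvd T else if k < 2 * L then 2 ^ (2 * L - k) dvd T else True)"
  unfolding schedule_def active_def key_div_mod[OF assms] Let_def by (rule refl)+

lemma schedule_key:
  "v < L \<Longrightarrow> schedule L (key L T v) = transfer L v (collects L v T) (collect_src v) (collect_dst v)"
  "v < L \<Longrightarrow> schedule L (key L T (2 * L - 1 - v)) =
    transfer L v (distributes L v T) (distribute_src v) (distribute_dst v)"
  "schedule L (key L T (2 * L)) = evaluation L T"
  by (simp_all add: schedule_key_if)

lemma active_key:
  "v < L \<Longrightarrow> active L (key L T v) \<longleftrightarrow> 2 ^ Suc v dvd T"
  "v < L \<Longrightarrow> active L (key L T (2 * L - 1 - v)) \<longleftrightarrow> 2 ^ Suc v dvd T"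
  "active L (key L T (2 * L))"
proof -
  show "active L (key L T v) \<longleftrightarrow> 2 ^ Suc v dvd T" if "v < L"
    using that by (subst schedule_key_if(2)) simp_all
  show "active L (key L T (2 * L - 1 - v)) \<longleftrightarrow> 2 ^ Suc v dvd T" if "v < L"
  proof -
    have "\<not> 2 * L - 1 - v < L" "2 * L - 1 - v < 2 * L" "2 * L - (2 * L - 1 - v) = Suc v"
      using that by linarith+
    moreover have "2 * L - 1 - v \<le> 2 * L"
      by simp
    ultimately show ?thesis
      by (simp only: schedule_key_if(2) if_True if_False)
  qed
  show "active L (key L T (2 * L))"
    by (subst schedule_key_if(2)) simp_all
qed

lemma plan_keyE:
  assumes "N \<in> set (plan_keys L)"
  obtains (collect) T v where "N = key L T v" "v < L" "T < horizon L" "2 ^ Suc v dvd T"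
  | (distribute) T v where "N = key L T (2 * L - 1 - v)" "v < L" "T < horizon L" "2 ^ Suc v dvd T"
  | (evaluate) T where "N = key L T (2 * L)" "T < horizon L"
proof -
  have N: "active L N" "N < horizon L * (2 * L + 1)"
    using assms by (auto simp: plan_keys_def)
  obtain T k where k: "N = key L T k" "k \<le> 2 * L"
    by (rule key_split)
  have T: "T < horizon L"
    using N(2) key_less_horizon[OF k(2)] k(1) by simp
  consider "k < L" | "L \<le> k" "k < 2 * L" | "k = 2 * L"
    using k(2) by linarith
  then show thesis
  proof cases
    case 1
    then show thesis
      using collect[of T k] k T N(1) active_key(1) by simp
  next
    case 2
    define v where "v = 2 * L - 1 - k"
    have "k = 2 * L - 1 - v" "v < L"
      using 2 by (auto simp: v_def)
    then show thesis
      using distribute[of T v] k T N(1) active_key(2)[of v L T] by simp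
  next
    case 3
    then show thesis
      using evaluate k T by simp
  qed
qed

section \<open>Values are in place when they are needed\<close>

definition known_before :: "nat \<Rightarrow> nat \<Rightarrow> (nat \<times> node) set" where
  "known_before L N = \<Union>(learned ` schedule L ` {r \<in> set (plan_keys L). r < N})"

lemma known_beforeI:
  assumes "k' \<le> 2 * L" "T < horizon L" "T' \<le> T" "T' = T \<Longrightarrow> k' < k" "active L (key L T' k')"
    and "x \<in> learned (schedule L (key L T' k'))"
  shows "x \<in> known_before L (key L T k)"
proof -
  have "key L T' k' < horizon L * (2 * L + 1)"
    using assms(1-3) key_less_horizon[of k' L T' "horizon L"] by simp
  then have "key L T' k' \<in> {r \<in> set (plan_keys L). r < key L T k}"
    using assms key_less[of T' T k' L k] by (simp add: plan_keys_def)
  then show ?thesis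
    unfolding known_before_def using assms(6) by blast
qed

lemma learned_transfer:
  assumes "u \<in> stencil_nodes (2 ^ L)" "P u"
  shows "(g u, u) \<in> learned (transfer L v P f g)"
proof -
  have "\<lparr>src = f u, dst = g u, payload = Some u\<rparr> \<in> set (msgs (transfer L v P f g))"
    using assms by (simp add: transfer_def image_iff del: split_paired_Ex)
  then show ?thesis
    unfolding learned_def delivered_def
    by (intro UnI2 CollectI exI[of _ "\<lparr>src = f u, dst = g u, payload = Some u\<rparr>"] exI[of _ u]) simp
qed

lemma learned_evaluation:
  "u \<in> stencil_nodes (2 ^ L) \<Longrightarrow> (owner u, u) \<in> learned (evaluation L (ready L u))"
  by (simp add: learned_def evaluation_def image_iff del: split_paired_Ex)

lemma msgs_ok_transfer:
  assumes "\<And>u. u \<in> stencil_nodes (2 ^ L) \<Longrightarrow> P u \<Longrightarrow> (f u, u) \<in> K"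
  shows "msgs_ok K (msgs (transfer L v P f g))"
  using assms unfolding msgs_ok_def transfer_def by (auto simp del: split_paired_All)

text \<open>Since \<open>T'\<close> is the first multiple of \<open>2 ^ v\<close> after \<open>ready L u\<close>, the value has climbed to level
  \<open>v\<close> by time \<open>T'\<close>.\<close>

lemma collected:
  assumes u: "u \<in> stencil_nodes (2 ^ L)" and "2 ^ v dvd Suc (owner u)" "Suc (owner u) < 2 ^ L"
    and "v < L" "2 ^ v dvd T" "ready L u < T" "T < horizon L"
  shows "(collect_src v u, u) \<in> known_before L (key L T v)"
proof (cases v)
  case 0
  then show ?thesis
    using assms learned_evaluation[OF u]
    by (intro known_beforeI[where T' = "ready L u" and k' = "2 * L"])
      (auto simp: collect_src_def active_key schedule_key)
next
  case (Suc w)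
  define T' where "T' = Suc (ready L u div 2 ^ v) * 2 ^ v"
  have "ready L u div 2 ^ v < T div 2 ^ v"
    using assms(5,6) by (auto elim!: dvdE simp: less_mult_imp_div_less mult.commute)
  then have "T' \<le> T"
    using assms(5) unfolding T'_def by (metis Suc_leI dvd_div_mult_self mult_le_mono1)
  moreover have "ready L u < T'" "T' \<le> ready L u + 2 ^ v"
    using dividend_less_div_times[of "2 ^ v" "ready L u"] by (simp_all add: T'_def add.commute)
  moreover have "2 ^ w dvd Suc (owner u)"
    using assms(2) Suc by (meson dvd_trans le_SucI le_imp_power_dvd le_refl)
  ultimately have "collects L w T' u"
    using assms Suc by (simp add: collects_def)
  moreover have "collect_dst w u = collect_src v u"
    using assms(2) Suc by (simp add: collect_dst_def collect_src_def)
  ultimately have "(collect_src v u, u) \<in> learned (schedule L (key L T' w))"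
    using learned_transfer[OF u, of "collects L w T'" "collect_dst w"] assms(4) Suc
    by (simp add: schedule_key)
  moreover have "active L (key L T' w)"
    using active_key(1)[of w L T'] assms(4) Suc by (simp add: T'_def)
  ultimately show ?thesis
    using \<open>T' \<le> T\<close> assms(4,7) Suc by (intro known_beforeI[where T' = T' and k' = w]) auto
qed

text \<open>The value arrives at time \<open>wanted L u\<close>, rounded down to a multiple of
  \<open>2 ^ Suc v\<close>, either by a distributing superstep of level \<open>v\<close> or, if
  \<open>v\<close> is the level of the boundary, by crossing. Only the receipt is at stake here;
  that the sender holds the value is part of \<open>msgs_ok_plan\<close>.\<close>

lemma distributed:
  assumes u: "u \<in> stencil_nodes (2 ^ L)" and "2 ^ v dvd Suc (owner u)" "Suc (owner u) < 2 ^ L"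
    and "v < L" "wanted L u div 2 ^ Suc v * 2 ^ Suc v \<le> T" "T < horizon L" "2 * L - v \<le> k"
  shows "(slot v (Suc (owner u)) (snd u), u) \<in> known_before L (key L T k)"
proof -
  define T' where "T' = wanted L u div 2 ^ Suc v * 2 ^ Suc v"
  have T': "T' \<le> wanted L u" "wanted L u < T' + 2 ^ Suc v" "2 ^ Suc v dvd T'" "T' \<le> T"
    using dividend_less_div_times[of "2 ^ Suc v" "wanted L u"] assms(5)
    by (simp_all only: T'_def div_times_less_eq_dividend add.commute zero_less_power zero_less_numeral dvd_triv_right)
  show ?thesis
  proof (cases "2 ^ Suc v dvd Suc (owner u)")
    case True
    then have "(distribute_dst v u, u) \<in> learned (schedule L (key L T' (2 * L - 1 - v)))"
      using T' assms by (subst schedule_key) (auto intro!: learned_transfer simp: distributes_def)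
    then show ?thesis
      using T' assms active_key(2)[of v L T'] unfolding distribute_dst_def
      by (intro known_beforeI[where T' = T' and k' = "2 * L - 1 - v"]) auto
  next
    case False
    \<comment> \<open>The delay across the boundary equals the period of the level, so the rounded
      time falls into the window of \<open>collects\<close>.\<close>
    then have "wanted L u = ready L u + 2 ^ Suc v"
      using delay_Suc[OF assms(4,2)] by (simp add: wanted_def ready_def)
    then have "collects L v T' u"
      using T' assms by (simp add: collects_def)
    then have "(collect_dst v u, u) \<in> learned (schedule L (key L T' v))"
      using u assms(4) by (subst schedule_key) (auto intro!: learned_transfer)
    then show ?thesis
      using T' assms active_key(1)[of v L T'] False unfolding collect_dst_def
      by (intro known_beforeI[where T' = T' and k' = v]) auto
  qed
qed

lemma evals_ok_plan:
  assumes "N \<in> set (plan_keys L)" "L > 0"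
  shows "evals_ok (2 ^ L) (known_before L N) (evals (schedule L N))"
  using assms(1)
proof (cases rule: plan_keyE)
  case (evaluate T)
  show ?thesis
  proof (rule evals_okI)
    fix j w assume "(j, w) \<in> set (evals (schedule L N))"
    then have w: "j = owner w" "w \<in> stencil_nodes (2 ^ L)" "ready L w = T"
      by (auto simp: evaluate schedule_key evaluation_def)
    then show "w \<in> stencil_nodes (2 ^ L)"
      by simp
    fix u assume arc: "stencil_arc (2 ^ L) u w"
    then have u: "u \<in> stencil_nodes (2 ^ L)"
      by (simp add: stencil_arc_def)
    from arc_owner(1)[OF arc] show "(j, u) \<in> known_before L N"
    proof
      assume "owner w = owner u"
      then have "T = Suc (ready L u)"
        using w(3) arc_owner(2)[OF arc] by (simp add: ready_def)
      then show ?thesis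
        using learned_evaluation[OF u] w(1) \<open>owner w = owner u\<close> evaluate
        by (auto intro!: known_beforeI[where T' = "ready L u" and k' = "2 * L"] simp: active_key schedule_key)
    next
      assume own: "owner w = Suc (owner u)"
      then have "T = Suc (wanted L u)"
        using w(3) arc_owner(2)[OF arc] by (simp add: ready_def wanted_def)
      \<comment> \<open>On level 0 the slot is the processing element itself.\<close>
      then have "wanted L u div 2 ^ Suc 0 * 2 ^ Suc 0 \<le> T"
        by (meson div_times_less_eq_dividend le_SucI)
      then have "(slot 0 (Suc (owner u)) (snd u), u) \<in> known_before L (key L T (2 * L))"
        using evaluate own owner_less[OF w(2)] assms(2) by (intro distributed[OF u]) auto
      then show ?thesis
        using own w(1) evaluate(1) by simp
    qed
  qed
next
  case (collect T v)
  show ?thesis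
    unfolding collect(1) schedule_key(1)[OF collect(2)] by (simp add: transfer_def)
next
  case (distribute T v)
  show ?thesis
    unfolding distribute(1) schedule_key(2)[OF distribute(2)] by (simp add: transfer_def)
qed

lemma msgs_ok_plan:
  assumes "N \<in> set (plan_keys L)"
  shows "msgs_ok (known_before L N \<union> set (evals (schedule L N))) (msgs (schedule L N))"
  using assms
proof (cases rule: plan_keyE)
  case (collect T v)
  have "2 ^ v dvd T"
    using collect(4) by (meson dvd_trans le_SucI le_imp_power_dvd le_refl)
  then show ?thesis
    unfolding collect(1) schedule_key(1)[OF collect(2)] using collect
    by (intro msgs_ok_transfer UnI1 collected) (auto simp: collects_def)
next
  case (distribute T v)
  show ?thesis
    unfolding distribute(1) schedule_key(2)[OF distribute(2)]
  proof (intro msgs_ok_transfer UnI1)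
    fix u assume u: "u \<in> stencil_nodes (2 ^ L)" "distributes L v T u"
    \<comment> \<open>The sender of a distributing superstep of level \<open>v\<close> got the value
      on level \<open>Suc v\<close>, so that level has to exist.\<close>
    have "2 ^ Suc v \<le> Suc (owner u)" "Suc (owner u) < 2 ^ L"
      using u(2) unfolding distributes_def by (auto intro: dvd_imp_le)
    then have "(2 :: nat) ^ Suc v < 2 ^ L"
      by (rule le_less_trans)
    then have v: "Suc v < L"
      by (rule power_less_imp_less_exp[rotated]) simp
    have "wanted L u div 2 ^ Suc v < Suc (T div 2 ^ Suc v)"
      using u(2) distribute(4) unfolding distributes_def
      by (intro less_mult_imp_div_less) (auto elim!: dvdE simp: algebra_simps)
    then have "wanted L u div 2 ^ Suc v * 2 ^ Suc v \<le> T"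
      using distribute(4) by (metis dvd_div_mult_self less_Suc_eq_le mult_le_mono1)
    \<comment> \<open>Rounding down to the coarser multiples gives no later time, and within a time
      step level \<open>Suc v\<close> is distributed before level \<open>v\<close>.\<close>
    moreover have "wanted L u div 2 ^ Suc (Suc v) * 2 ^ Suc (Suc v) \<le> wanted L u div 2 ^ Suc v * 2 ^ Suc v"
    proof -
      have "wanted L u div 2 ^ Suc (Suc v) * 2 ^ Suc (Suc v) =
          wanted L u div 2 ^ Suc v div 2 * 2 * 2 ^ Suc v"
        by (simp add: div_mult2_eq[symmetric] mult.commute mult.left_commute)
      then show ?thesis
        by (metis div_times_less_eq_dividend mult_le_mono1)
    qed
    ultimately show "(distribute_src v u, u) \<in> known_before L (key L T (2 * L - 1 - v))"
      unfolding distribute_src_def using u v distribute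
      by (intro distributed) (auto simp: distributes_def)
  qed
next
  case (evaluate T)
  then show ?thesis
    by (simp add: schedule_key evaluation_def msgs_ok_def)
qed

lemma execution_ok_plan:
  assumes "L > 0"
  shows "execution_ok (2 ^ L) {} (plan L)"
  unfolding plan_def
proof (rule execution_ok_map_sorted, goal_cases)
  case 1
  show ?case
    by (simp add: plan_keys_def sorted_wrt_filter)
next
  case (2 N)
  show ?case
    using evals_ok_plan[OF 2 assms] by (simp add: known_before_def)
next
  case (3 N)
  show ?case
    using msgs_ok_plan[OF 3] by (simp add: known_before_def)
qed

section \<open>Clusters, labels and evaluations of the plan\<close>

lemma transfer_simps [simp]:
  "label (transfer L v P f g) = L - Suc v" "evals (transfer L v P f g) = []"
  by (simp_all add: transfer_def)

lemma evaluation_simps [simp]: "label (evaluation L T) = L - 1" "msgs (evaluation L T) = []"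
  by (simp_all add: evaluation_def)

lemma well_formed_transfer:
  assumes "v < L"
    and "\<And>u. u \<in> stencil_nodes (2 ^ L) \<Longrightarrow> P u \<Longrightarrow>
      f u < 2 ^ L \<and> g u < 2 ^ L \<and> f u div 2 ^ Suc v = g u div 2 ^ Suc v"
    and "m \<in> set (msgs (transfer L v P f g))"
  shows "src m < 2 ^ L \<and> dst m < 2 ^ L \<and> same_cluster (2 ^ L) (L - Suc v) (src m) (dst m)"
proof -
  have "L - (L - Suc v) = Suc v"
    using assms(1) by simp
  then have cluster: "same_cluster (2 ^ L) (L - Suc v) x y \<longleftrightarrow> x div 2 ^ Suc v = y div 2 ^ Suc v" for x y
    unfolding same_cluster_def floor_log_power by simp
  from assms(3) consider u where "u \<in> stencil_nodes (2 ^ L)" "P u" "src m = f u" "dst m = g u"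
    | a where "a < 2 ^ L" "src m = a" "dst m = sibling v a"
    unfolding transfer_def by (auto simp del: split_paired_Ex)
  then show ?thesis
  proof cases
    case 1
    then show ?thesis
      using assms(2)[of u] unfolding cluster by simp
  next
    case 2
    then show ?thesis
      using sibling_less[OF assms(1)] sibling_cluster[of v a] unfolding cluster by simp
  qed
qed

lemma well_formed_collect:
  assumes "v < L" "u \<in> stencil_nodes (2 ^ L)" "collects L v T u"
  shows "collect_src v u < 2 ^ L \<and> collect_dst v u < 2 ^ L \<and>
    collect_src v u div 2 ^ Suc v = collect_dst v u div 2 ^ Suc v"
proof -
  have less: "owner u < 2 ^ L" "Suc (owner u) < 2 ^ L"
    using assms(3) by (auto simp: collects_def)
  have up: "slot v j t div 2 ^ Suc v = j div 2 ^ Suc v" for j t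
    using slot_div by (rule div_eq_mono) simp
  have "Suc (owner u) div 2 ^ Suc v = owner u div 2 ^ Suc v" if "\<not> 2 ^ Suc v dvd Suc (owner u)"
    using that by (simp add: div_Suc dvd_eq_mod_eq_0)
  then show ?thesis
    using less slot_less[of v L] slot_less[of "Suc v" L] assms(1)
    by (simp add: collect_src_def collect_dst_def up slot_div del: power_Suc)
qed

lemma well_formed_distribute:
  assumes "v < L" "u \<in> stencil_nodes (2 ^ L)" "distributes L v T u"
  shows "distribute_src v u < 2 ^ L \<and> distribute_dst v u < 2 ^ L \<and>
    distribute_src v u div 2 ^ Suc v = distribute_dst v u div 2 ^ Suc v"
proof -
  have less: "Suc (owner u) < 2 ^ L"
    using assms(3) by (auto simp: distributes_def)
  have up: "slot v j t div 2 ^ Suc v = j div 2 ^ Suc v" for j t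
    using slot_div by (rule div_eq_mono) simp
  show ?thesis
    using less slot_less[of v L] slot_less[of "Suc v" L] assms(1)
    by (simp add: distribute_src_def distribute_dst_def up slot_div del: power_Suc)
qed

lemma well_formed_plan: "well_formed (2 ^ L) (plan L)"
  unfolding well_formed_def plan_def set_map
proof (rule ballI)
  fix s assume "s \<in> schedule L ` set (plan_keys L)"
  then obtain N where N: "s = schedule L N" "N \<in> set (plan_keys L)"
    by blast
  from N(2) show "(\<forall>e\<in>set (evals s). fst e < 2 ^ L) \<and>
     (\<forall>m\<in>set (msgs s). src m < 2 ^ L \<and> dst m < 2 ^ L \<and> same_cluster (2 ^ L) (label s) (src m) (dst m))"
  proof (cases rule: plan_keyE)
    case (collect T v)
    show ?thesis
      unfolding N(1) collect(1) schedule_key(1)[OF collect(2)]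
      using well_formed_transfer[OF collect(2) well_formed_collect[OF collect(2)]] by simp
  next
    case (distribute T v)
    show ?thesis
      unfolding N(1) distribute(1) schedule_key(2)[OF distribute(2)]
      using well_formed_transfer[OF distribute(2) well_formed_distribute[OF distribute(2)]] by simp
  next
    case (evaluate T)
    have "owner u < 2 ^ L" if "u \<in> stencil_nodes (2 ^ L)" for u
      using owner_less[OF that] .
    then show ?thesis
      unfolding N(1) evaluate(1) schedule_key(3) by (auto simp: evaluation_def simp del: split_paired_All)
  qed
qed

lemma label_plan:
  assumes "s \<in> set (plan L)" "L > 0" shows "label s < L"
proof -
  obtain N where N: "s = schedule L N" "N \<in> set (plan_keys L)"
    using assms(1) by (auto simp: plan_def)
  from N(2) show ?thesis
  proof (cases rule: plan_keyE)
    case (collect T v)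
    then show ?thesis
      unfolding N(1) collect(1) schedule_key(1)[OF collect(2)] by simp
  next
    case (distribute T v)
    then show ?thesis
      unfolding N(1) distribute(1) schedule_key(2)[OF distribute(2)] by simp
  next
    case (evaluate T)
    then show ?thesis
      unfolding N(1) evaluate(1) schedule_key(3) using assms(2) by simp
  qed
qed

text \<open>A node determines the only key at which it is evaluated; this excludes
  recomputation.\<close>

lemma in_evals_schedule:
  assumes "N \<in> set (plan_keys L)" "(j, u) \<in> set (evals (schedule L N))"
  shows "j = owner u \<and> u \<in> stencil_nodes (2 ^ L) \<and> N = key L (ready L u) (2 * L)"
  using assms(1)
proof (cases rule: plan_keyE)
  case (collect T v)
  then show ?thesis
    using assms(2) unfolding collect(1) schedule_key(1)[OF collect(2)] by simp
next
  case (distribute T v)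
  then show ?thesis
    using assms(2) unfolding distribute(1) schedule_key(2)[OF distribute(2)] by simp
next
  case (evaluate T)
  then show ?thesis
    using assms(2) unfolding evaluate(1) schedule_key(3) by (auto simp: evaluation_def)
qed

lemma all_evals_plan:
  "set (all_evals (plan L)) = (\<lambda>u. (owner u, u)) ` stencil_nodes (2 ^ L)"
proof (intro equalityI subsetI)
  fix e assume "e \<in> set (all_evals (plan L))"
  then obtain N where "N \<in> set (plan_keys L)" "e \<in> set (evals (schedule L N))"
    by (auto simp: all_evals_def plan_def)
  then show "e \<in> (\<lambda>u. (owner u, u)) ` stencil_nodes (2 ^ L)"
    using in_evals_schedule[of N L "fst e" "snd e"] by (cases e) auto
next
  fix e assume "e \<in> (\<lambda>u. (owner u, u)) ` stencil_nodes (2 ^ L)"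
  then obtain u where u: "e = (owner u, u)" "u \<in> stencil_nodes (2 ^ L)"
    by blast
  have "key L (ready L u) (2 * L) \<in> set (plan_keys L)"
    using key_less_horizon[of "2 * L" L "ready L u" "horizon L"] ready_less_horizon[OF u(2)] active_key(3)
    by (simp add: plan_keys_def)
  moreover have "e \<in> set (evals (schedule L (key L (ready L u) (2 * L))))"
    using u by (simp add: schedule_key(3) evaluation_def image_iff del: split_paired_Ex)
  ultimately show "e \<in> set (all_evals (plan L))"
    unfolding all_evals_def plan_def by auto
qed

lemma distinct_concat_map:
  assumes "distinct ks" "\<And>k. k \<in> set ks \<Longrightarrow> distinct (g k)"
    and "\<And>k k' x. k \<in> set ks \<Longrightarrow> k' \<in> set ks \<Longrightarrow> x \<in> set (g k) \<Longrightarrow> x \<in> set (g k') \<Longrightarrow> k = k'"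
  shows "distinct (concat (map g ks))"
  using assms
proof (induction ks)
  case (Cons k ks)
  have "distinct (concat (map g ks))"
    using Cons.prems by (intro Cons.IH) auto
  moreover have "set (g k) \<inter> (\<Union>k\<in>set ks. set (g k)) = {}"
    using Cons.prems(1) Cons.prems(3)[of k] by fastforce
  ultimately show ?case
    using Cons.prems(2) by simp
qed simp

lemma no_recomputation_plan: "no_recomputation (plan L)"
proof -
  have "distinct (concat (map (\<lambda>N. map snd (evals (schedule L N))) (plan_keys L)))"
  proof (rule distinct_concat_map)
    show "distinct (plan_keys L)"
      by (simp add: plan_keys_def)
  next
    fix N assume N: "N \<in> set (plan_keys L)"
    then show "distinct (map snd (evals (schedule L N)))"
    proof (cases rule: plan_keyE)
      case (collect T v)
      then show ?thesis
        unfolding collect(1) schedule_key(1)[OF collect(2)] by simp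
    next
      case (distribute T v)
      then show ?thesis
        unfolding distribute(1) schedule_key(2)[OF distribute(2)] by simp
    next
      case (evaluate T)
      then show ?thesis
        unfolding evaluate(1) schedule_key(3) by (simp add: evaluation_def comp_def)
    qed
  next
    fix N N' u assume "N \<in> set (plan_keys L)" "N' \<in> set (plan_keys L)"
      "u \<in> set (map snd (evals (schedule L N)))" "u \<in> set (map snd (evals (schedule L N')))"
    then obtain j j' where "N \<in> set (plan_keys L)" "(j, u) \<in> set (evals (schedule L N))"
      "N' \<in> set (plan_keys L)" "(j', u) \<in> set (evals (schedule L N'))"
      by auto
    then show "N = N'"
      using in_evals_schedule[of N L j u] in_evals_schedule[of N' L j' u] by simp
  qed
  then show ?thesis
    by (simp add: no_recomputation_def all_evals_def plan_def map_concat comp_def)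
qed

lemma solves_stencil_plan: "L > 0 \<Longrightarrow> solves_stencil (2 ^ L) (2 ^ L) (plan L)"
  unfolding solves_stencil_def
  using well_formed_plan execution_ok_plan all_evals_plan[of L] by (simp add: image_image)

text \<open>A processing element of a folding with at least two of them misses one of the two corner
  quadrants \<open>{..<h} \<times> {..<h}\<close> and \<open>{h..<2 * h} \<times> {h..<2 * h}\<close>.\<close>

lemma work_plan:
  assumes "1 \<le> b" "b \<le> L"
  shows "real (work j (map (fold_superstep (2 ^ L) (2 ^ b)) (plan L))) \<le> 3 / 4 * real (2 ^ L) ^ 2"
proof -
  define h :: nat where "h = 2 ^ (L - 1)"
  have h: "2 ^ L = 2 * h"
    using assms unfolding h_def by (metis One_nat_def Suc_le_D Suc_pred' le_trans power_Suc zero_less_Suc not_less_eq_eq not_gr_zero)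
  define W where "W = {u \<in> stencil_nodes (2 ^ L). owner u div 2 ^ (L - b) = j}"
  let ?es = "filter (\<lambda>e. fst e div 2 ^ (L - b) = j) (all_evals (plan L))"
  have "distinct (all_evals (plan L))"
    using no_recomputation_plan by (simp add: no_recomputation_def distinct_map)
  then have "length ?es = card (set ?es)"
    by (intro distinct_card[symmetric] distinct_filter)
  also have "set ?es = (\<lambda>u. (owner u, u)) ` W"
    using all_evals_plan[of L] by (auto simp: W_def)
  also have "card \<dots> = card W"
    by (intro card_image) (auto simp: inj_on_def)
  finally have work: "work j (map (fold_superstep (2 ^ L) (2 ^ b)) (plan L)) = card W"
    by (simp add: work_fold pow2_div[OF assms(2)])
  \<comment> \<open>For \<open>j < 2 ^ b\<close> the right-hand side is the leading bit of
    \<open>j\<close>: all owners folded into \<open>j\<close> lie in the same half of the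
    machine.\<close>
  have half: "owner u div h = j div 2 ^ (b - 1)" if "u \<in> W" for u
  proof -
    have "owner u div h = owner u div 2 ^ (L - b) div 2 ^ (b - 1)"
      using assms by (simp add: h_def div_mult2_eq[symmetric] power_add[symmetric])
    then show ?thesis
      using that by (simp add: W_def)
  qed
  have "\<exists>Q. Q \<subseteq> stencil_nodes (2 ^ L) \<and> card Q = h * h \<and> W \<subseteq> stencil_nodes (2 ^ L) - Q"
  proof (cases "j div 2 ^ (b - 1) = 0")
    case True
    have "owner u \<ge> h" if "u \<in> {h..<2 * h} \<times> {h..<2 * h}" for u
      using that by (auto simp: owner_def)
    then have "u \<notin> W" if "u \<in> {h..<2 * h} \<times> {h..<2 * h}" for u
      using that half[of u] True by (force simp: h_def div_eq_0_iff)
    then show ?thesis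
      by (intro exI[of _ "{h..<2 * h} \<times> {h..<2 * h}"])
        (auto simp: stencil_nodes_def h W_def simp del: split_paired_All)
  next
    case False
    have "owner u < h" if "u \<in> {..<h} \<times> {..<h}" for u
      using that by (auto simp: owner_def)
    then have "u \<notin> W" if "u \<in> {..<h} \<times> {..<h}" for u
      using that half[of u] False by force
    then show ?thesis
      by (intro exI[of _ "{..<h} \<times> {..<h}"])
        (auto simp: stencil_nodes_def h W_def simp del: split_paired_All)
  qed
  then obtain Q where Q: "Q \<subseteq> stencil_nodes (2 ^ L)" "card Q = h * h" "W \<subseteq> stencil_nodes (2 ^ L) - Q"
    by blast
  have fin: "finite (stencil_nodes (2 ^ L))"
    by (simp add: stencil_nodes_def)
  have "card W \<le> card (stencil_nodes (2 ^ L) - Q)"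
    using Q(3) fin by (intro card_mono) auto
  also have "\<dots> = 2 ^ L * 2 ^ L - h * h"
    using Q(1,2) fin finite_subset by (subst card_Diff_subset) (auto simp: stencil_nodes_def)
  also have "\<dots> = 3 * (h * h)"
    by (simp add: h)
  finally have "real (card W) \<le> real (3 * (h * h))"
    by (simp only: of_nat_le_iff)
  then have "real (card W) \<le> 3 / 4 * (2 * real h) ^ 2"
    by (simp add: power2_eq_square)
  moreover have "real (2 ^ L) = 2 * real h"
    unfolding h by simp
  ultimately show ?thesis
    unfolding work by (simp only:)
qed

section \<open>Cost of the algorithm\<close>

lemma card_le_8:
  fixes c :: "'a \<Rightarrow> bool \<times> bool \<times> bool"
  assumes "inj_on c A" shows "card A \<le> 8"
proof -
  have "card A = card (c ` A)"
    using assms by (simp add: card_image)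
  also have "\<dots> \<le> card (UNIV :: (bool \<times> bool \<times> bool) set)"
    by (intro card_mono) auto
  finally show ?thesis
    by (simp add: card_cartesian_product flip: UNIV_Times_UNIV)
qed

lemma length_filter_eq_le:
  assumes "distinct xs" "inj_on f (set xs)"
  shows "length (filter (\<lambda>x. f x = a) xs) \<le> 1"
proof -
  have "length (filter (\<lambda>x. f x = a) xs) = card ({x. f x = a} \<inter> set xs)"
    using assms(1) by (rule distinct_length_filter)
  also have "\<dots> \<le> Suc 0"
    using assms(2) by (subst card_le_Suc0_iff_eq) (auto simp: inj_on_def)
  finally show ?thesis
    by simp
qed

text \<open>At most 8 messages with a value, one for each color, and at most one dummy
  message.\<close>

lemma length_transfer_le:
  fixes c c' :: "node \<Rightarrow> bool \<times> bool \<times> bool"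
  assumes "inj_on c {u \<in> stencil_nodes (2 ^ L). P u \<and> f u = a}"
    and "inj_on c' {u \<in> stencil_nodes (2 ^ L). P u \<and> g u = a}"
  shows "length (filter (\<lambda>m. src m = a) (msgs (transfer L v P f g))) \<le> 9"
    and "length (filter (\<lambda>m. dst m = a) (msgs (transfer L v P f g))) \<le> 9"
proof -
  have payload: "length (filter (\<lambda>u. P u \<and> h u = a) (node_list (2 ^ L))) \<le> 8"
    if "inj_on d {u \<in> stencil_nodes (2 ^ L). P u \<and> h u = a}"
    for d :: "node \<Rightarrow> bool \<times> bool \<times> bool" and h
  proof -
    have "length (filter (\<lambda>u. P u \<and> h u = a) (node_list (2 ^ L))) =
        card ({u. P u \<and> h u = a} \<inter> stencil_nodes (2 ^ L))"
      using distinct_length_filter[of "node_list (2 ^ L)"] by simp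
    also have "{u. P u \<and> h u = a} \<inter> stencil_nodes (2 ^ L) = {u \<in> stencil_nodes (2 ^ L). P u \<and> h u = a}"
      by blast
    finally show ?thesis
      using card_le_8[OF that] by simp
  qed
  have "length (filter (\<lambda>x. x = a) [0..<2 ^ L]) \<le> 1"
    using length_filter_eq_le[of "[0..<2 ^ L]" "\<lambda>x. x" a] by simp
  then show "length (filter (\<lambda>m. src m = a) (msgs (transfer L v P f g))) \<le> 9"
    using payload[OF assms(1)] by (simp add: transfer_def filter_map comp_def conj_commute)
  have "length (filter (\<lambda>x. sibling v x = a) [0..<2 ^ L]) \<le> 1"
    using inj_sibling[of v] by (intro length_filter_eq_le) (auto intro: inj_on_subset)
  then show "length (filter (\<lambda>m. dst m = a) (msgs (transfer L v P f g))) \<le> 9"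
    using payload[OF assms(2)] by (simp add: transfer_def filter_map comp_def conj_commute)
qed

text \<open>Among the nodes that one processing element sends or receives in one superstep, a node is
  determined by its color.\<close>

definition color :: "nat \<Rightarrow> node \<Rightarrow> bool \<times> bool \<times> bool" where
  "color v u = (2 ^ Suc v dvd Suc (owner u), odd (fst u + snd u), odd (snd u div 2 ^ v))"

lemma mod_eq_near:
  fixes a b d :: nat
  assumes "a mod d = b mod d" "a < b + d" "b < a + d"
  shows "a = b"
proof -
  have "x = y" if "x \<le> y" "y < x + d" "x mod d = y mod d" for x y :: nat
  proof -
    have "d dvd y - x"
      using that by (metis mod_eq_dvd_iff_nat)
    moreover have "y - x < d"
      using that by simp
    ultimately show ?thesis
      using that(1) dvd_imp_le[of d "y - x"] by force
  qed
  then show ?thesis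
    using assms by (metis nat_le_linear)
qed

text \<open>The third color component extends the residue of the row from modulus
  \<open>2 ^ v\<close> to \<open>2 ^ Suc v\<close>, the length of the window, and so fixes the row.
  The second one decides between the two diagonals of the owner.\<close>

lemma color_eqD:
  assumes "color v u = color v u'" "owner u = owner u'" "snd u mod 2 ^ v = snd u' mod 2 ^ v"
    and "snd u < snd u' + 2 ^ Suc v" "snd u' < snd u + 2 ^ Suc v"
  shows "u = u'"
proof -
  have "snd u div 2 ^ v mod 2 = snd u' div 2 ^ v mod 2"
    using assms(1) unfolding color_def by (simp add: mod2_eq_if)
  then have "snd u mod 2 ^ Suc v = snd u' mod 2 ^ Suc v"
    using assms(3) by (simp only: power_Suc2 mod_mult2_eq)
  then have snd: "snd u = snd u'"
    using assms(4,5) by (rule mod_eq_near)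
  have "(fst u + snd u) div 2 = (fst u' + snd u') div 2" "odd (fst u + snd u) = odd (fst u' + snd u')"
    using assms(1,2) by (simp_all add: owner_def color_def)
  moreover have "x = y" if "x div 2 = y div 2" "odd x = odd y" for x y :: nat
    using that by presburger
  ultimately have "fst u + snd u = fst u' + snd u'"
    by blast
  then show ?thesis
    using snd by (simp add: prod_eq_iff)
qed

lemma slot_eqD:
  assumes "slot v j t = slot v j' t'"
  shows "j div 2 ^ v = j' div 2 ^ v" "t mod 2 ^ v = t' mod 2 ^ v"
  using assms slot_div slot_mod by metis+

lemma cluster_end_unique:
  fixes j j' d :: nat
  assumes "j div d = j' div d" "d dvd Suc j" "d dvd Suc j'"
  shows "j = j'"
proof -
  have "Suc j div d = Suc (j div d)" "Suc j' div d = Suc (j' div d)"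
    using assms(2,3) by (simp_all add: div_Suc dvd_eq_mod_eq_0)
  then have "Suc j = Suc j'"
    using assms by (metis dvd_div_mult_self)
  then show ?thesis
    by simp
qed

lemma cluster_start_unique:
  fixes j j' d :: nat
  assumes "j div d = j' div d" "d dvd j" "d dvd j'"
  shows "j = j'"
  using assms by (metis dvd_div_mult_self)

lemma pow2_Suc_dvd: "2 ^ Suc v dvd (x :: nat) \<Longrightarrow> 2 ^ v dvd x"
  by (meson dvd_trans le_SucI le_imp_power_dvd le_refl)

lemma pow2_Suc_mod: "(x :: nat) mod 2 ^ Suc v = y mod 2 ^ Suc v \<Longrightarrow> x mod 2 ^ v = y mod 2 ^ v"
  by (metis le_SucI le_imp_power_dvd le_refl mod_mod_cancel)

text \<open>Equal owners have equal delays, so the window for \<open>ready\<close> is a window for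
  the row.\<close>

lemma collect_eqD:
  assumes "collects L v T u" "collects L v T u'" "color v u = color v u'"
    and "owner u = owner u'" "snd u mod 2 ^ v = snd u' mod 2 ^ v"
  shows "u = u'"
  using assms by (intro color_eqD) (auto simp: collects_def ready_def)

lemma distribute_eqD:
  assumes "distributes L v T u" "distributes L v T u'" "color v u = color v u'"
    and "owner u = owner u'" "snd u mod 2 ^ v = snd u' mod 2 ^ v"
  shows "u = u'"
  using assms by (intro color_eqD) (auto simp: distributes_def wanted_def)

text \<open>A slot determines its cluster and the row modulo the cluster size. The boundary lies at
  the end of the owner's cluster or at the start of the next one, so the cluster determines the
  owner. At the destination, the first color component separates climbing values from crossing
  ones.\<close>

lemma inj_collect:
  "inj_on (color v) {u \<in> stencil_nodes n. collects L v T u \<and> collect_src v u = a}" (is "inj_on _ ?S")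
  "inj_on (color v) {u \<in> stencil_nodes n. collects L v T u \<and> collect_dst v u = a}" (is "inj_on _ ?D")
proof -
  show "inj_on (color v) ?S"
  proof (rule inj_onI)
    fix u u' assume u: "u \<in> ?S" "u' \<in> ?S" and c: "color v u = color v u'"
    then have "slot v (owner u) (snd u) = slot v (owner u') (snd u')"
      by (simp add: collect_src_def)
    note slot = slot_eqD[OF this]
    have "owner u = owner u'"
      using slot(1) by (rule cluster_end_unique) (use u in \<open>simp_all add: collects_def\<close>)
    then show "u = u'"
      using u c slot(2) by (intro collect_eqD[of L v T]) simp_all
  qed
  show "inj_on (color v) ?D"
  proof (rule inj_onI)
    fix u u' assume u: "u \<in> ?D" "u' \<in> ?D" and c: "color v u = color v u'"
    have dvd: "2 ^ Suc v dvd Suc (owner u) \<longleftrightarrow> 2 ^ Suc v dvd Suc (owner u')"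
      using c by (simp add: color_def)
    have eq: "collect_dst v u = collect_dst v u'"
      using u by simp
    have "owner u = owner u' \<and> snd u mod 2 ^ v = snd u' mod 2 ^ v"
    proof (cases "2 ^ Suc v dvd Suc (owner u)")
      case True
      then have "slot (Suc v) (owner u) (snd u) = slot (Suc v) (owner u') (snd u')"
        using eq dvd by (simp add: collect_dst_def)
      note slot = slot_eqD[OF this]
      show ?thesis
        using cluster_end_unique[OF slot(1)] pow2_Suc_mod[OF slot(2)] True dvd by blast
    next
      case False
      then have "slot v (Suc (owner u)) (snd u) = slot v (Suc (owner u')) (snd u')"
        using eq dvd by (simp add: collect_dst_def)
      note slot = slot_eqD[OF this]
      have "Suc (owner u) = Suc (owner u')"
        using slot(1) by (rule cluster_start_unique) (use u in \<open>simp_all add: collects_def\<close>)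
      then show ?thesis
        using slot(2) by simp
    qed
    then show "u = u'"
      using u c by (intro collect_eqD[of L v T]) simp_all
  qed
qed

text \<open>As for \<open>inj_collect\<close>, with \<open>Suc (owner u)\<close> as the start of the
  receiving cluster.\<close>

lemma inj_distribute:
  "inj_on (color v) {u \<in> stencil_nodes n. distributes L v T u \<and> distribute_src v u = a}" (is "inj_on _ ?S")
  "inj_on (color v) {u \<in> stencil_nodes n. distributes L v T u \<and> distribute_dst v u = a}" (is "inj_on _ ?D")
proof -
  show "inj_on (color v) ?S"
  proof (rule inj_onI)
    fix u u' assume u: "u \<in> ?S" "u' \<in> ?S" and c: "color v u = color v u'"
    then have "slot (Suc v) (Suc (owner u)) (snd u) = slot (Suc v) (Suc (owner u')) (snd u')"
      by (simp add: distribute_src_def)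
    note slot = slot_eqD[OF this]
    have "Suc (owner u) = Suc (owner u')"
      using slot(1) by (rule cluster_start_unique) (use u in \<open>simp_all add: distributes_def\<close>)
    then show "u = u'"
      using u c pow2_Suc_mod[OF slot(2)] by (intro distribute_eqD[of L v T]) simp_all
  qed
  show "inj_on (color v) ?D"
  proof (rule inj_onI)
    fix u u' assume u: "u \<in> ?D" "u' \<in> ?D" and c: "color v u = color v u'"
    then have "slot v (Suc (owner u)) (snd u) = slot v (Suc (owner u')) (snd u')"
      by (simp add: distribute_dst_def)
    note slot = slot_eqD[OF this]
    have "2 ^ v dvd Suc (owner u)" "2 ^ v dvd Suc (owner u')"
      using u by (auto simp: distributes_def simp del: power_Suc intro: pow2_Suc_dvd)
    then have "Suc (owner u) = Suc (owner u')"
      by (rule cluster_start_unique[OF slot(1)])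
    then show "u = u'"
      using u c slot(2) by (intro distribute_eqD[of L v T]) simp_all
  qed
qed

lemma length_plan_le:
  assumes "s \<in> set (plan L)"
  shows "length (filter (\<lambda>m. src m = a) (msgs s)) \<le> 9" "length (filter (\<lambda>m. dst m = a) (msgs s)) \<le> 9"
proof -
  obtain N where N: "s = schedule L N" "N \<in> set (plan_keys L)"
    using assms by (auto simp: plan_def)
  from N(2) have "length (filter (\<lambda>m. src m = a) (msgs s)) \<le> 9 \<and>
      length (filter (\<lambda>m. dst m = a) (msgs s)) \<le> 9"
  proof (cases rule: plan_keyE)
    case (collect T v)
    show ?thesis
      unfolding N(1) collect(1) schedule_key(1)[OF collect(2)]
      using length_transfer_le[OF inj_collect] by blast
  next
    case (distribute T v)
    show ?thesis
      unfolding N(1) distribute(1) schedule_key(2)[OF distribute(2)]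
      using length_transfer_le[OF inj_distribute] by blast
  next
    case (evaluate T)
    then show ?thesis
      unfolding N(1) evaluate(1) schedule_key(3) by simp
  qed
  then show "length (filter (\<lambda>m. src m = a) (msgs s)) \<le> 9" "length (filter (\<lambda>m. dst m = a) (msgs s)) \<le> 9"
    by simp_all
qed

lemma degree_plan_le:
  assumes "s \<in> set (plan L)" "b \<le> L"
  shows "superstep_degree (2 ^ b) (fold_superstep (2 ^ L) (2 ^ b) s) \<le> 9 * 2 ^ (L - b)"
  using superstep_degree_fold_le[OF length_plan_le[OF assms(1)], of "2 ^ b" "2 ^ L"]
  by (simp add: pow2_div[OF assms(2)])

section \<open>Wiseness of single supersteps\<close>

text \<open>The dummy messages suffice: processing element 0 stands for \<open>2 ^ (L - b)\<close>
  original ones, and since \<open>L - b \<le> v\<close> all their siblings lie outside of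
  it.\<close>

lemma degree_transfer_ge:
  assumes "v < L" "b \<le> L" "L - Suc v < b"
  shows "2 ^ (L - b) \<le> superstep_degree (2 ^ b) (fold_superstep (2 ^ L) (2 ^ b) (transfer L v P f g))"
proof -
  let ?w = "2 ^ (L - b) :: nat"
  have "{..<?w} \<subseteq> {a. a div ?w = 0 \<and> sibling v a div ?w \<noteq> 0} \<inter> set [0..<2 ^ L]"
  proof
    fix a assume "a \<in> {..<?w}"
    then have a: "a < ?w" "a div ?w = 0"
      by simp_all
    moreover have "a < 2 ^ L"
      using a(1) by (rule less_le_trans) simp
    moreover have "sibling v a div ?w \<noteq> 0"
      using sibling_neq[of "L - b" v a] assms a(2) by simp
    ultimately show "a \<in> {a. a div ?w = 0 \<and> sibling v a div ?w \<noteq> 0} \<inter> set [0..<2 ^ L]"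
      by simp
  qed
  then have "card {..<?w} \<le> card ({a. a div ?w = 0 \<and> sibling v a div ?w \<noteq> 0} \<inter> set [0..<2 ^ L])"
    by (intro card_mono) auto
  also have "\<dots> = length (filter (\<lambda>a. a div ?w = 0 \<and> sibling v a div ?w \<noteq> 0) [0..<2 ^ L])"
    by (rule distinct_length_filter[symmetric]) simp
  also have "\<dots> \<le> sent 0 (fold_superstep (2 ^ L) (2 ^ b) (transfer L v P f g))"
    by (simp add: sent_def msgs_fold transfer_def filter_map comp_def pow2_div[OF assms(2)])
  also have "\<dots> \<le> superstep_degree (2 ^ b) (fold_superstep (2 ^ L) (2 ^ b) (transfer L v P f g))"
    unfolding superstep_degree_def by (rule order_trans[OF max.cobounded1 Max_ge]) auto
  finally show ?thesis
    by simp
qed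

text \<open>Transfers have degree at most 9 before folding and at least \<open>2 ^ (L - b)\<close>
  after it, while evaluations have degree 0 before folding. Hence the wiseness constant
  \<open>1 / 9\<close>.\<close>

lemma wise_degree_plan:
  assumes "s \<in> set (plan L)" "b \<le> L" "label s < b"
  shows "2 ^ (L - b) * superstep_degree (2 ^ L) s \<le>
    9 * superstep_degree (2 ^ b) (fold_superstep (2 ^ L) (2 ^ b) s)"
proof -
  have le9: "superstep_degree (2 ^ L) s \<le> 9"
    using degree_plan_le[OF assms(1) order_refl] by (simp add: fold_superstep_id)
  have wise: ?thesis if "2 ^ (L - b) \<le> superstep_degree (2 ^ b) (fold_superstep (2 ^ L) (2 ^ b) s)"
    using mult_le_mono[OF that le9] by (simp add: mult.commute)
  obtain N where N: "s = schedule L N" "N \<in> set (plan_keys L)"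
    using assms by (auto simp: plan_def)
  from N(2) show ?thesis
  proof (cases rule: plan_keyE)
    case (collect T v)
    have s: "s = transfer L v (collects L v T) (collect_src v) (collect_dst v)"
      unfolding N(1) collect(1) schedule_key(1)[OF collect(2)] ..
    show ?thesis
      by (rule wise) (use assms(2,3) collect(2) in \<open>simp add: s degree_transfer_ge\<close>)
  next
    case (distribute T v)
    have s: "s = transfer L v (distributes L v T) (distribute_src v) (distribute_dst v)"
      unfolding N(1) distribute(1) schedule_key(2)[OF distribute(2)] ..
    show ?thesis
      by (rule wise) (use assms(2,3) distribute(2) in \<open>simp add: s degree_transfer_ge\<close>)
  next
    case (evaluate T)
    have "s = evaluation L T"
      unfolding N(1) evaluate(1) schedule_key(3) ..
    then have "(\<lambda>j. max (sent j s) (received j s)) ` {..<2 ^ L} = {0}"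
      by (simp add: sent_def received_def image_constant_conv lessThan_empty_iff)
    then show ?thesis
      by (simp add: superstep_degree_def)
  qed
qed

section \<open>Number of supersteps and total cost\<close>

lemma card_multiples_le:
  fixes H d :: nat
  assumes "d > 0" shows "card {T. T < H \<and> d dvd T} \<le> H div d + 1"
proof -
  have "{T. T < H \<and> d dvd T} \<subseteq> (\<lambda>q. d * q) ` {..H div d}"
  proof
    fix T assume "T \<in> {T. T < H \<and> d dvd T}"
    then have "T = d * (T div d)" "T div d \<le> H div d"
      by (auto intro: div_le_mono)
    then show "T \<in> (\<lambda>q. d * q) ` {..H div d}"
      by blast
  qed
  then have "card {T. T < H \<and> d dvd T} \<le> card ((\<lambda>q. d * q) ` {..H div d})"
    by (intro card_mono) auto
  also have "\<dots> \<le> H div d + 1"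
    using card_image_le[of "{..H div d}" "\<lambda>q. d * q"] by simp
  finally show ?thesis .
qed

text \<open>Label \<open>m\<close> belongs to level \<open>L - Suc m\<close>, whose two supersteps
  recur every \<open>2 ^ (L - m)\<close> time steps, that is, at most \<open>2 ^ m * (L + 3)\<close>
  times each before the horizon. The sum over \<open>m < l\<close> is geometric.\<close>

lemma count_supersteps:
  assumes "1 \<le> l" "l \<le> L"
  shows "length (filter (\<lambda>s. label s < l) (plan L)) \<le> 3 * 2 ^ l * (L + 3)"
proof -
  define M where "M m = {T. T < horizon L \<and> 2 ^ (L - m) dvd T}" for m
  define X where "X m = (\<lambda>T. key L T (L - Suc m)) ` M m \<union> (\<lambda>T. key L T (2 * L - 1 - (L - Suc m))) ` M m" for m
  \<comment> \<open>Evaluations carry the label \<open>L - 1\<close> and are counted only if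
    \<open>l = L\<close>.\<close>
  define E where "E = (if l = L then (\<lambda>T. key L T (2 * L)) ` {..<horizon L} else {})"
  have fin: "finite (M m)" for m
    by (simp add: M_def)
  have "length (filter (\<lambda>s. label s < l) (plan L)) =
      length (filter (\<lambda>N. label (schedule L N) < l) (plan_keys L))"
    by (simp add: plan_def filter_map comp_def)
  also have "\<dots> = card (set (filter (\<lambda>N. label (schedule L N) < l) (plan_keys L)))"
    by (rule distinct_card[symmetric]) (simp add: plan_keys_def)
  also have "\<dots> \<le> card ((\<Union>m<l. X m) \<union> E)"
  proof (rule card_mono)
    show "finite ((\<Union>m<l. X m) \<union> E)"
      using fin by (simp add: X_def E_def)
    show "set (filter (\<lambda>N. label (schedule L N) < l) (plan_keys L)) \<subseteq> (\<Union>m<l. X m) \<union> E"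
    proof
      fix N assume "N \<in> set (filter (\<lambda>N. label (schedule L N) < l) (plan_keys L))"
      then have N: "N \<in> set (plan_keys L)" "label (schedule L N) < l"
        by simp_all
      from N(1) show "N \<in> (\<Union>m<l. X m) \<union> E"
      proof (cases rule: plan_keyE)
        case (collect T v)
        define m where "m = L - Suc v"
        have m: "L - Suc m = v" "L - m = Suc v"
          using collect(2) by (simp_all add: m_def)
        have "m < l"
          using N(2) unfolding collect(1) schedule_key(1)[OF collect(2)] by (simp add: m_def)
        moreover have "N \<in> X m"
          unfolding X_def M_def m using collect by blast
        ultimately show ?thesis
          by blast
      next
        case (distribute T v)
        define m where "m = L - Suc v"
        have m: "L - Suc m = v" "L - m = Suc v"
          using distribute(2) by (simp_all add: m_def)
        have "m < l"
          using N(2) unfolding distribute(1) schedule_key(2)[OF distribute(2)] by (simp add: m_def)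
        moreover have "N \<in> X m"
          unfolding X_def M_def m using distribute by blast
        ultimately show ?thesis
          by blast
      next
        case (evaluate T)
        then have "l = L"
          using N(2) assms(2) unfolding evaluate(1) schedule_key(3) by simp
        then show ?thesis
          using evaluate by (simp add: E_def)
      qed
    qed
  qed
  also have "\<dots> \<le> card (\<Union>m<l. X m) + card E"
    by (rule card_Un_le)
  finally have count: "length (filter (\<lambda>s. label s < l) (plan L)) \<le> card (\<Union>m<l. X m) + card E" .
  have "card (\<Union>m<l. X m) \<le> (\<Sum>m<l. card (X m))"
    by (rule card_UN_le) simp
  also have "\<dots> \<le> (\<Sum>m<l. 2 ^ m * (2 * (L + 3)))"
  proof (rule sum_mono)
    fix m assume "m \<in> {..<l}"
    then have "2 ^ L = 2 ^ (L - m) * (2 ^ m :: nat)"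
      using assms(2) by (simp add: power_add[symmetric])
    then have "horizon L div 2 ^ (L - m) = 2 ^ m * (L + 2)"
      by (simp add: horizon_def mult.assoc)
    moreover have "1 \<le> (2 :: nat) ^ m"
      by simp
    moreover have "card (M m) \<le> horizon L div 2 ^ (L - m) + 1"
      unfolding M_def by (rule card_multiples_le) simp
    moreover have "2 ^ m * (L + 3) = 2 ^ m * (L + 2) + 2 ^ m"
      by (simp add: algebra_simps)
    ultimately have "card (M m) \<le> 2 ^ m * (L + 3)"
      by linarith
    moreover have "card (X m) \<le> card (M m) + card (M m)"
      unfolding X_def by (rule order_trans[OF card_Un_le add_mono]) (rule card_image_le[OF fin])+
    moreover have "2 ^ m * (2 * (L + 3)) = 2 ^ m * (L + 3) + 2 ^ m * (L + 3)"
      by (simp add: algebra_simps)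
    ultimately show "card (X m) \<le> 2 ^ m * (2 * (L + 3))"
      by linarith
  qed
  also have "\<dots> = (\<Sum>m<l. 2 ^ m) * (2 * (L + 3))"
    by (simp add: sum_distrib_right)
  also have "\<dots> \<le> 2 ^ l * (2 * (L + 3))"
  proof (rule mult_le_mono1)
    show "(\<Sum>m<l. 2 ^ m) \<le> (2 :: nat) ^ l"
      by (induction l) auto
  qed
  finally have X: "card (\<Union>m<l. X m) \<le> 2 ^ l * (2 * (L + 3))" .
  have "card E \<le> 2 ^ l * (L + 3)"
  proof (cases "l = L")
    case True
    have "card E \<le> horizon L"
      using card_image_le[of "{..<horizon L}" "\<lambda>T. key L T (2 * L)"] True by (simp add: E_def)
    then show ?thesis
      using True by (simp add: horizon_def algebra_simps)
  qed (simp add: E_def)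
  moreover have "3 * 2 ^ l * (L + 3) = 2 ^ l * (2 * (L + 3)) + 2 ^ l * (L + 3)"
    by (simp add: algebra_simps)
  ultimately show ?thesis
    using count X by linarith
qed

text \<open>With \<open>n = 2 ^ L\<close> and \<open>p = 2 ^ b\<close>, each charged superstep costs
  at most \<open>(9 + c) * n / p\<close>, and there are at most \<open>3 * p * (L + 3)\<close> of
  them; \<open>p\<close> cancels, and \<open>L + 3 \<le> 4 * L\<close>.\<close>

lemma comm_complexity_plan:
  assumes "1 \<le> b" "b \<le> L" "0 \<le> \<sigma>" "\<sigma> \<le> c * (2 ^ L / 2 ^ b)"
  shows "comm_complexity (2 ^ b) \<sigma> (map (fold_superstep (2 ^ L) (2 ^ b)) (plan L)) \<le>
    12 * (9 + c) * (2 ^ L * real L)"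
proof -
  define B where "B = (9 + c) * (2 ^ L / 2 ^ b)"
  have w: "(2 :: real) ^ (L - b) = 2 ^ L / 2 ^ b"
    using assms(2) by (simp add: power_diff)
  have deg: "real (superstep_degree (2 ^ b) (fold_superstep (2 ^ L) (2 ^ b) s)) + \<sigma> \<le> B" if "s \<in> set (plan L)" for s
  proof -
    have "real (superstep_degree (2 ^ b) (fold_superstep (2 ^ L) (2 ^ b) s)) \<le> real (9 * 2 ^ (L - b))"
      using degree_plan_le[OF that assms(2)] by (simp only: of_nat_le_iff)
    then show ?thesis
      using assms(4) by (simp add: B_def w distrib_right add_divide_distrib)
  qed
  have "0 \<le> c * (2 ^ L / 2 ^ b)"
    using assms(3,4) by linarith
  then have "B \<ge> 0"
    unfolding B_def distrib_right by simp
  have const: "(\<Sum>s\<leftarrow>xs. if P s then B else 0) = real (length (filter P xs)) * B" for P and xs :: "superstep list"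
    by (induction xs) (auto simp: algebra_simps)
  have "comm_complexity (2 ^ b) \<sigma> (map (fold_superstep (2 ^ L) (2 ^ b)) (plan L)) \<le>
      (\<Sum>s\<leftarrow>plan L. if label s < b then B else 0)"
    unfolding comm_complexity_eq by (simp add: comp_def) (intro sum_list_mono, simp add: deg)
  also have "\<dots> = real (length (filter (\<lambda>s. label s < b) (plan L))) * B"
    by (rule const)
  also have "\<dots> \<le> real (3 * 2 ^ b * (L + 3)) * B"
    using count_supersteps[OF assms(1,2)] \<open>B \<ge> 0\<close> by (intro mult_right_mono) (simp_all only: of_nat_le_iff)
  also have "\<dots> = 3 * (real L + 3) * ((9 + c) * 2 ^ L)"
    by (simp add: B_def)
  also have "\<dots> \<le> 3 * (4 * real L) * ((9 + c) * 2 ^ L)"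
  proof (intro mult_right_mono mult_left_mono)
    have "(9 + c) * 2 ^ L = B * 2 ^ b"
      by (simp add: B_def)
    then show "0 \<le> (9 + c) * 2 ^ L"
      using \<open>B \<ge> 0\<close> by simp
  qed (use assms(1,2) in simp_all)
  finally show ?thesis
    by (simp add: mult_ac)
qed

lemma wise_plan:
  assumes "1 \<le> L"
  shows "wise_on (2 ^ L) (2 ^ L) (1 / 9) (2 ^ L) (\<lambda>_ :: 'v list. plan L)"
proof -
  have "1 / 9 * (real (2 ^ L) / 2 ^ j) * (\<Sum>i<j. real (total_degree i (2 ^ L) (map (fold_superstep (2 ^ L) (2 ^ L)) (plan L))))
      \<le> (\<Sum>i<j. real (total_degree i (2 ^ j) (map (fold_superstep (2 ^ L) (2 ^ j)) (plan L))))"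
    if j: "j \<le> L" for j
  proof -
    have w: "real (2 ^ L) / 2 ^ j = 2 ^ (L - j)"
      using j by (simp add: power_diff)
    have "1 / 9 * 2 ^ (L - j) * real (superstep_degree (2 ^ L) s)
        \<le> real (superstep_degree (2 ^ j) (fold_superstep (2 ^ L) (2 ^ j) s))"
      if "s \<in> set (plan L)" "label s < j" for s
    proof -
      have "real (2 ^ (L - j) * superstep_degree (2 ^ L) s) \<le>
          real (9 * superstep_degree (2 ^ j) (fold_superstep (2 ^ L) (2 ^ j) s))"
        using wise_degree_plan[OF that(1) j that(2)] by (simp only: of_nat_le_iff)
      then show ?thesis
        by simp
    qed
    then show ?thesis
      unfolding w sum_total_degree_eq sum_list_const_mult[symmetric] map_map comp_def
      by (intro sum_list_mono) (simp add: fold_superstep_id)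
  qed
  moreover have "1 < (2 :: nat) ^ L"
    using assms by (intro one_less_power) simp_all
  ultimately show ?thesis
    by (simp add: wise_on_def fold_algorithm_def del: of_nat_power)
qed

text \<open>The quadratic term of the exponential series at \<open>sqrt x\<close> is
  \<open>x / 2\<close>, and 4 exceeds the base of the exponential.\<close>

lemma le_4_powr_sqrt: "x \<le> 2 * 4 powr sqrt x" if "x \<ge> 0" for x :: real
proof -
  have "exp 1 \<le> (4 :: real)"
    using exp_le by linarith
  then have ln4: "1 \<le> ln (4 :: real)"
    by (simp add: ln_ge_iff)
  have "x / 2 \<le> 1 + sqrt x + (sqrt x)\<^sup>2 / 2"
    using that by simp
  also have "\<dots> \<le> exp (sqrt x)"
    using that by (intro exp_lower_Taylor_quadratic) simp
  also have "\<dots> \<le> exp (sqrt x * ln 4)"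
    using mult_left_mono[OF ln4, of "sqrt x"] that by simp
  finally show ?thesis
    by (simp add: powr_def)
qed

theorem theorem5:
  shows "\<exists>\<epsilon>::real. 0 < \<epsilon> \<and> \<epsilon> < 1 \<and>
    (\<exists>A :: nat \<Rightarrow> 'v algorithm.
      (\<forall>n. 2 \<le> n \<and> is_pow2 n \<longrightarrow>
         static_algorithm_specified_on n n (A n) \<and> stencil_class \<epsilon> n n (A n)) \<and>
      (\<forall>c>0. \<exists>C>0. \<forall>n p. \<forall>\<sigma>::real.
         2 \<le> n \<and> is_pow2 n \<and> is_pow2 p \<and> 1 < p \<and> p \<le> n \<and>
         0 \<le> \<sigma> \<and> \<sigma> \<le> c * (real n / real p) \<longrightarrow>
         (\<forall>x\<in>inputs n. comm_complexity p \<sigma> (fold_algorithm n p (A n) x)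
                        \<le> C * (real n * 4 powr sqrt (lg (real n))))) \<and>
      (\<exists>\<alpha>>0. \<forall>n. 2 \<le> n \<and> is_pow2 n \<longrightarrow> wise_on n n \<alpha> n (A n)) \<and>
      (\<forall>c>0. \<exists>b>0. \<forall>n p. \<forall>\<sigma>::real.
         2 \<le> n \<and> is_pow2 n \<and> is_pow2 p \<and> 1 < p \<and> p \<le> n \<and>
         0 \<le> \<sigma> \<and> \<sigma> \<le> c * (real n / real p) \<longrightarrow>
         optimal_on (b / 4 powr sqrt (lg (real n))) \<epsilon> n p \<sigma> (fold_algorithm n p (A n))))"
\<comment> \<open>The value \<open>3 / 4\<close> satisfies both \<open>work_plan\<close> and the
  lower bound.\<close>
proof (rule exI[of _ "3 / 4"], (rule conjI, simp)+,
    rule exI[of _ "\<lambda>n. \<lambda>_ :: 'v list. plan (floor_log n)"], intro conjI)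
  let ?A = "\<lambda>n. \<lambda>_ :: 'v list. plan (floor_log n)"
  have pow2: "\<exists>b. m = 2 ^ b \<and> 1 \<le> b" if "2 \<le> m" "is_pow2 m" for m
    using that unfolding is_pow2_def by (metis One_nat_def Suc_leI bot_nat_0.not_eq_extremum
      less_one linorder_not_less numeral_2_eq_2 power_0 lessI)
  have lg: "lg (real (2 ^ L)) = real L" if "1 \<le> L" for L
    using that by (simp add: lg_def log_nat_power)
  have cls: "stencil_class (3 / 4) (2 ^ L) (2 ^ b) (fold_algorithm (2 ^ L) (2 ^ b) (\<lambda>_ :: 'v list. plan L))"
    if "1 \<le> b" "b \<le> L" for b L
    using that by (intro stencil_class_fold solves_stencil_plan no_recomputation_plan work_plan) simp_all
  have upper: "comm_complexity p \<sigma> (fold_algorithm n p (?A n) x) \<le> 24 * (9 + c) * (real n * 4 powr sqrt (lg (real n)))"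
    if asm: "c > 0" "2 \<le> n \<and> is_pow2 n \<and> is_pow2 p \<and> 1 < p \<and> p \<le> n \<and> 0 \<le> \<sigma> \<and> \<sigma> \<le> c * (real n / real p)"
    for c \<sigma> n p x
  proof -
    obtain L b where L: "n = 2 ^ L" "1 \<le> L" and b: "p = 2 ^ b" "1 \<le> b"
      using pow2[of n] pow2[of p] asm by auto
    have "b \<le> L"
      using asm L b by simp
    then have "comm_complexity p \<sigma> (fold_algorithm n p (?A n) x) \<le> 12 * (9 + c) * (2 ^ L * real L)"
      using comm_complexity_plan[of b L \<sigma> c] asm L b by (simp add: fold_algorithm_def)
    also have "\<dots> \<le> 12 * (9 + c) * (2 ^ L * (2 * 4 powr sqrt (real L)))"
      using asm(1) by (intro mult_left_mono le_4_powr_sqrt) simp_all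
    finally show ?thesis
      using lg[OF L(2)] L(1) by (simp add: algebra_simps)
  qed
  show "\<forall>n. 2 \<le> n \<and> is_pow2 n \<longrightarrow>
      static_algorithm_specified_on n n (?A n) \<and> stencil_class (3 / 4) n n (?A n)"
  proof (intro allI impI)
    fix n assume "2 \<le> n \<and> is_pow2 n"
    then obtain L where L: "n = 2 ^ L" "1 \<le> L"
      using pow2 by blast
    then have "stencil_class (3 / 4) n n (?A n)"
      using cls[of L L] by (simp add: fold_algorithm_def fold_superstep_id map_idI)
    moreover have "static_algorithm_specified_on n n (?A n)"
      using L solves_stencil_plan[of L] label_plan[of _ L]
      by (simp add: static_algorithm_specified_on_def static_on_def)
    ultimately show "static_algorithm_specified_on n n (?A n) \<and> stencil_class (3 / 4) n n (?A n)"
      by simp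
  qed
  show "\<forall>c>0. \<exists>C>0. \<forall>n p. \<forall>\<sigma>::real.
      2 \<le> n \<and> is_pow2 n \<and> is_pow2 p \<and> 1 < p \<and> p \<le> n \<and> 0 \<le> \<sigma> \<and> \<sigma> \<le> c * (real n / real p) \<longrightarrow>
      (\<forall>x\<in>inputs n. comm_complexity p \<sigma> (fold_algorithm n p (?A n) x)
         \<le> C * (real n * 4 powr sqrt (lg (real n))))"
  proof (intro allI impI)
    fix c :: real assume c: "c > 0"
    then show "\<exists>C>0. \<forall>n p. \<forall>\<sigma>::real.
      2 \<le> n \<and> is_pow2 n \<and> is_pow2 p \<and> 1 < p \<and> p \<le> n \<and> 0 \<le> \<sigma> \<and> \<sigma> \<le> c * (real n / real p) \<longrightarrow>
      (\<forall>x\<in>inputs n. comm_complexity p \<sigma> (fold_algorithm n p (?A n) x)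
         \<le> C * (real n * 4 powr sqrt (lg (real n))))"
      using upper[OF c] by (intro exI[of _ "24 * (9 + c)"]) auto
  qed
  show "\<exists>\<alpha>>0. \<forall>n. 2 \<le> n \<and> is_pow2 n \<longrightarrow> wise_on n n \<alpha> n (?A n)"
  proof (intro exI[of _ "1 / 9"] conjI allI impI)
    fix n assume "2 \<le> n \<and> is_pow2 n"
    then obtain L where L: "n = 2 ^ L" "1 \<le> L"
      using pow2 by blast
    then show "wise_on n n (1 / 9) n (?A n)"
      using wise_plan[OF L(2)] by simp
  qed simp
  show "\<forall>c>0. \<exists>b>0. \<forall>n p. \<forall>\<sigma>::real.
      2 \<le> n \<and> is_pow2 n \<and> is_pow2 p \<and> 1 < p \<and> p \<le> n \<and> 0 \<le> \<sigma> \<and> \<sigma> \<le> c * (real n / real p) \<longrightarrow>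
      optimal_on (b / 4 powr sqrt (lg (real n))) (3 / 4) n p \<sigma> (fold_algorithm n p (?A n))"
  proof (intro allI impI)
    fix c :: real assume c: "c > 0"
    \<comment> \<open>\<open>C\<close> is the constant of the upper bound; together with the 12 of
      the lower bound it gives the ratio \<open>12 * C * K\<close>.\<close>
    define C where "C = 24 * (9 + c)"
    have C: "C \<ge> 1"
      using c by (simp add: C_def)
    have "optimal_on (1 / (12 * C) / 4 powr sqrt (lg (real n))) (3 / 4) n p \<sigma> (fold_algorithm n p (?A n))"
      if asm: "2 \<le> n \<and> is_pow2 n \<and> is_pow2 p \<and> 1 < p \<and> p \<le> n \<and> 0 \<le> \<sigma> \<and> \<sigma> \<le> c * (real n / real p)"
      for n p and \<sigma> :: real
    proof -
      define K where "K = 4 powr sqrt (lg (real n))"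
      have K: "K \<ge> 1"
        unfolding K_def by (rule ge_one_powr_ge_zero) (simp_all add: lg_def)
      obtain L b where L: "n = 2 ^ L" "1 \<le> L" and b: "p = 2 ^ b" "1 \<le> b"
        using pow2[of n] pow2[of p] asm by auto
      have "b \<le> L"
        using asm L b by simp
      then have "stencil_class (3 / 4) n p (fold_algorithm n p (?A n))"
        using cls[of b L] L b by simp
      moreover have "comm_complexity p \<sigma> (fold_algorithm n p (?A n) x) \<le>
          1 / (1 / (12 * C) / K) * comm_complexity p \<sigma> (B' x)"
        if "stencil_class (3 / 4) n p B'" "x \<in> inputs n" for B' :: "'v algorithm" and x
      proof -
        have "comm_complexity p \<sigma> (fold_algorithm n p (?A n) x) \<le> C * K * real n"
          using upper[OF c asm, of x] by (simp add: C_def K_def mult_ac)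
        also have "\<dots> \<le> C * K * (12 * comm_complexity p \<sigma> (B' x))"
          using comm_complexity_lower_bound[OF that(1) _ _ that(2), of \<sigma>] asm C K
          by (intro mult_left_mono) simp_all
        finally show ?thesis
          by (simp add: mult_ac)
      qed
      moreover have "0 < 1 / (12 * C) / K" "1 / (12 * C) / K \<le> 1"
        using C K mult_mono[of 1 "12 * C" 1 K] by (simp_all add: divide_simps)
      ultimately show ?thesis
        unfolding optimal_on_def K_def[symmetric] by blast
    qed
    then show "\<exists>b>0. \<forall>n p. \<forall>\<sigma>::real.
      2 \<le> n \<and> is_pow2 n \<and> is_pow2 p \<and> 1 < p \<and> p \<le> n \<and> 0 \<le> \<sigma> \<and> \<sigma> \<le> c * (real n / real p) \<longrightarrow>
      optimal_on (b / 4 powr sqrt (lg (real n))) (3 / 4) n p \<sigma> (fold_algorithm n p (?A n))"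
      using C by (intro exI[of _ "1 / (12 * C)"]) auto
  qed
qed

end
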